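(* Let $X=\{X(t),t\ge t_0\}$ be a diffusion process such that $X(t_0)=x_0$. Let $a(t)$ and $b(t)$ be two time dependent boundaries with bounded derivatives such that $a(t_0)<x_0<b(t_0)$ and $a(t)<b(t)$ for each $t>t_0$. Then the densities $g_a(t|x_0,t_0)$ and $g_b(t|x_0,t_0)$ are a solution of the following system of Volterra integral equations of the first kind, for $t>t_0$: $$1-F_{X(t)}(b(t)|x_0,t_0)=\int_{t_0}^t\left[1-F_{X(t)}(b(t)|a(\tau),\tau)\right]g_a(\tau|x_0,t_0)\,d\tau+\int_{t_0}^t\left[1-F_{X(t)}(b(t)|b(\tau),\tau)\right]g_b(\tau|x_0,t_0)\,d\tau,$$ $$F_{X(t)}(a(t)|x_0,t_0)=\int_{t_0}^tF_{X(t)}(a(t)|a(\tau),\tau)\,g_a(\tau|x_0,t_0)\,d\tau+\int_{t_0}^tF_{X(t)}(a(t)|b(\tau),\tau)\,g_b(\tau|x_0,t_0)\,d\tau.$$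
   Context: $X=\{X(t),t\ge t_0\}$ is a one-dimensional regular time homogeneous diffusion process on a probability space $(\Omega,\mathcal A,\mathbb P)$ with $P(X(t_0)=x_0)=1$ and diffusion interval $I$ (an interval with endpoints $r_1<r_2$, possibly infinite; unless otherwise specified $I$ is open and $r_1,r_2$ are natural boundaries), having transition distribution function $F_{X(t)}(x|y,\tau)=P(X(t)\le x|X(\tau)=y)$ and transition density $f_{X(t)}(x|y,\tau)$. The boundaries $a(t),b(t)$ are continuous and take values in $I$. The first hitting times are $T_a=\inf\{t\ge t_0:X(t)=a(t)\}$ and $T_b=\inf\{t\ge t_0:X(t)=b(t)\}$. The functions $g_a,g_b$ are the (sub-probability) densities, assumed to exist, defined by $$g_a(t|x_0,t_0)\,dt=P(T_a\in dt,\ T_a<T_b|X(t_0)=x_0),\qquad g_b(t|x_0,t_0)\,dt=P(T_b\in dt,\ T_a>T_b|X(t_0)=x_0).$$ *)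

theory Defs
  imports "HOL-Probability.Probability"
begin

text \<open>
  A process is a map \<open>X :: real \<Rightarrow> 'a \<Rightarrow> real\<close> on a probability space \<open>M\<close>; only its values \<open>X t\<close> with
  \<open>t \<ge> t0\<close> matter. A time homogeneous transition function is a map \<open>p\<close>, where \<open>p s y\<close> is the law at
  time \<open>\<tau> + s\<close> of the process that is at \<open>y\<close> at time \<open>\<tau>\<close>.
\<close>

definition natural_filtration ::
  "'a measure \<Rightarrow> real \<Rightarrow> (real \<Rightarrow> 'a \<Rightarrow> real) \<Rightarrow> real \<Rightarrow> 'a measure" where
  "natural_filtration M t0 X t =
     sigma (space M) (\<Union>s\<in>{t0..t}. {X s -` B \<inter> space M | B. B \<in> sets borel})"

lemma filtration_natural_filtration: "filtration (space M) (natural_filtration M t0 X)"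
proof
  show "space (natural_filtration M t0 X i) = space M" for i
    by (auto simp: natural_filtration_def intro!: space_measure_of)
next
  fix i j :: real assume "i \<le> j"
  then show "sets (natural_filtration M t0 X i) \<le> sets (natural_filtration M t0 X j)"
    unfolding natural_filtration_def
    by (subst (1 2) sets_measure_of) (fastforce intro!: sigma_sets_mono')+
qed

text \<open>
  The strong Markov property
  \<open>P (X (T + s) \<in> B | F\<^sub>T) = p s (X T) B\<close>. Restricting it to real-valued stopping times is no loss:
  for a stopping time with values in \<open>[t0, \<infinity>]\<close>, the property on \<open>{T < \<infinity>}\<close> follows by
  applying this one to the truncations \<open>min T n\<close>. Constant \<open>T\<close> give the Markov property.
\<close>

definition strong_markov ::
  "'a measure \<Rightarrow> real \<Rightarrow> (real \<Rightarrow> 'a \<Rightarrow> real) \<Rightarrow> (real \<Rightarrow> real \<Rightarrow> real measure) \<Rightarrow> bool" where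
  "strong_markov M t0 X p \<longleftrightarrow>
     (\<forall>T. stopping_time (natural_filtration M t0 X) T \<and> (\<forall>\<omega>\<in>space M. t0 \<le> T \<omega>) \<longrightarrow>
       (\<forall>s\<ge>0. \<forall>B\<in>sets borel.
          AE \<omega> in M.
            real_cond_exp M (filtration.pre_sigma (space M) (natural_filtration M t0 X) T)
              (indicator {\<omega> \<in> space M. X (T \<omega> + s) \<omega> \<in> B}) \<omega>
            = measure (p s (X (T \<omega>) \<omega>)) B))"

definition diffusion_process ::
  "'a measure \<Rightarrow> real \<Rightarrow> (real \<Rightarrow> 'a \<Rightarrow> real) \<Rightarrow> real set \<Rightarrow> (real \<Rightarrow> real \<Rightarrow> real measure)
     \<Rightarrow> real \<Rightarrow> bool" where
  "diffusion_process M t0 X I p x0 \<longleftrightarrow>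
     prob_space M \<and>
     (\<forall>t\<ge>t0. X t \<in> borel_measurable M) \<and>
     (\<forall>\<omega>\<in>space M. continuous_on {t0..} (\<lambda>t. X t \<omega>) \<and> (\<forall>t\<ge>t0. X t \<omega> \<in> I)) \<and>
     (AE \<omega> in M. X t0 \<omega> = x0) \<and>
     strong_markov M t0 X p"

text \<open>The value is \<open>\<infinity>\<close> if the path of \<open>X\<close> never meets \<open>c\<close>.\<close>

definition hitting_time ::
  "real \<Rightarrow> (real \<Rightarrow> 'a \<Rightarrow> real) \<Rightarrow> (real \<Rightarrow> real) \<Rightarrow> 'a \<Rightarrow> ereal" where
  "hitting_time t0 X c \<omega> = Inf (ereal ` {t. t0 \<le> t \<and> X t \<omega> = c t})"

text \<open>
  Regularity (every state is reached with positive probability from every other one) and the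
  nature of the boundaries are properties of the diffusion started at an arbitrary point of the
  diffusion interval, so they involve a family \<open>(Q y, Y)\<close> of diffusions, started at \<open>y\<close> at time \<open>0\<close>,
  with the common transition function \<open>p\<close>.

  The endpoints are natural in the sense of Breiman's probabilistic form of Feller's
  classification: they cannot be reached (all paths stay in the open interval), and they are not
  entrance boundaries, that is, the probability of reaching a fixed interior point within a fixed
  time tends to \<open>0\<close> as the starting point tends to the endpoint.
\<close>

definition regular_diffusion_family ::
  "ereal \<Rightarrow> ereal \<Rightarrow> (real \<Rightarrow> real \<Rightarrow> real measure) \<Rightarrow> (real \<Rightarrow> 'b measure)
     \<Rightarrow> (real \<Rightarrow> 'b \<Rightarrow> real) \<Rightarrow> bool" where
  "regular_diffusion_family r1 r2 p Q Y \<longleftrightarrow>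
     r1 < r2 \<and>
     (\<forall>s\<ge>0. p s \<in> restrict_space borel (einterval r1 r2) \<rightarrow>\<^sub>M prob_algebra borel) \<and>
     (\<forall>s>0. \<forall>y\<in>einterval r1 r2.
        \<exists>f\<in>borel_measurable borel. (\<forall>x. 0 \<le> f x) \<and> p s y = density lborel (\<lambda>x. ennreal (f x))) \<and>
     (\<forall>y\<in>einterval r1 r2. diffusion_process (Q y) 0 Y (einterval r1 r2) p y) \<and>
     (\<forall>x\<in>einterval r1 r2. \<forall>y\<in>einterval r1 r2.
        0 < measure (Q x) {\<omega> \<in> space (Q x). hitting_time 0 Y (\<lambda>_. y) \<omega> < \<infinity>}) \<and>
     (\<forall>y\<in>einterval r1 r2. \<forall>t>0. \<forall>L\<in>{at_right r1, at_left r2}.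
        ((\<lambda>x. measure (Q x) {\<omega> \<in> space (Q x). hitting_time 0 Y (\<lambda>_. y) \<omega> \<le> ereal t}) \<longlongrightarrow> 0)
          (filtercomap ereal L))"

text \<open>\<open>transition_cdf p t x y \<tau>\<close> is \<open>F\<^bsub>X(t)\<^esub>(x | y, \<tau>) = P (X(t) \<le> x | X(\<tau>) = y)\<close>.\<close>

definition transition_cdf ::
  "(real \<Rightarrow> real \<Rightarrow> real measure) \<Rightarrow> real \<Rightarrow> real \<Rightarrow> real \<Rightarrow> real \<Rightarrow> real" where
  "transition_cdf p t x y \<tau> = cdf (p (t - \<tau>) y) x"

text \<open>\<open>g(t) dt = P (T \<in> dt, T < S)\<close> on \<open>[t0, \<infinity>)\<close>.\<close>

definition first_hit_density ::
  "'a measure \<Rightarrow> real \<Rightarrow> ('a \<Rightarrow> ereal) \<Rightarrow> ('a \<Rightarrow> ereal) \<Rightarrow> (real \<Rightarrow> real) \<Rightarrow> bool" where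
  "first_hit_density M t0 T S g \<longleftrightarrow>
     set_borel_measurable lborel {t0..} g \<and>
     (\<forall>t\<ge>t0. 0 \<le> g t) \<and>
     (\<forall>A\<in>sets borel. A \<subseteq> {t0..} \<longrightarrow>
        emeasure M {\<omega> \<in> space M. T \<omega> \<in> ereal ` A \<and> T \<omega> < S \<omega>} = (\<integral>\<^sup>+t\<in>A. ennreal (g t) \<partial>lborel))"

definition differentiable_with_bounded_derivative :: "real \<Rightarrow> (real \<Rightarrow> real) \<Rightarrow> bool" where
  "differentiable_with_bounded_derivative t0 c \<longleftrightarrow>
     (\<exists>c'. (\<forall>t\<ge>t0. (c has_real_derivative c' t) (at t within {t0..})) \<and> bounded (c' ` {t0..}))"

end

theory Submission
  imports Defs
begin

text \<open>
  Let \<open>S\<close> be the first time at which \<open>X\<close> meets one of the boundaries. By continuity of the paths,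
  \<open>X t > b t\<close> or \<open>X t < a t\<close> is possible only if \<open>S < t\<close>, so conditioning on \<open>S\<close> and \<open>X S\<close> gives
  \<open>P (X t > b t) = E [1 - F (b t | X S, S); S < t]\<close>, and likewise for \<open>a\<close>. Splitting according to
  which boundary is met first turns the expectation into the integrals against \<open>g\<^sub>a\<close> and \<open>g\<^sub>b\<close>.

  The Markov property is needed at a fixed time \<open>t\<close>, hence after the random delay \<open>t - S\<close>. This is
  obtained by discretizing the delay: the distribution function \<open>cdf (p s y) c\<close> is continuous in
  \<open>s > 0\<close>, because \<open>p s y\<close> is the law at time \<open>s\<close> of a continuous process and has no atoms. The same
  continuity gives the measurability in \<open>\<tau>\<close> of the kernels of the integral equations.
\<close>

section \<open>Discretization of time on a grid\<close>

text \<open>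
  Rounding up (rather than down) keeps the elapsed time positive, where the transition laws have no
  atoms; the truncation by \<open>nat\<close> makes \<open>grid n u\<close> positive also for the irrelevant \<open>u < 0\<close>.
\<close>

definition grid :: "nat \<Rightarrow> real \<Rightarrow> real" where
  "grid n u = (real (nat \<lfloor>real (Suc n) * u\<rfloor>) + 1) / real (Suc n)"

lemma grid_pos: "0 < grid n u"
  by (simp add: grid_def)

lemma grid_bounds:
  assumes "0 \<le> u"
  shows "u \<le> grid n u" "grid n u \<le> u + 1 / real (Suc n)"
proof -
  have *: "real (nat \<lfloor>real (Suc n) * u\<rfloor>) = of_int \<lfloor>real (Suc n) * u\<rfloor>"
    using assms by simp
  have "real (Suc n) * u \<le> of_int \<lfloor>real (Suc n) * u\<rfloor> + 1"
    by linarith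
  then show "u \<le> grid n u"
    unfolding grid_def * by (simp add: field_simps)
  have "of_int \<lfloor>real (Suc n) * u\<rfloor> + 1 \<le> real (Suc n) * u + 1"
    by linarith
  then show "grid n u \<le> u + 1 / real (Suc n)"
    unfolding grid_def * by (auto simp: divide_le_eq distrib_left distrib_right mult.commute simp del: of_nat_Suc)
qed

lemma grid_tendsto:
  assumes "0 \<le> u"
  shows "(\<lambda>n. grid n u) \<longlonglongrightarrow> u"
proof (rule tendsto_sandwich[where f = "\<lambda>_. u" and h = "\<lambda>n. u + 1 / real (Suc n)"])
  have "(\<lambda>n. 1 / real (Suc n)) \<longlonglongrightarrow> 0"
    using LIMSEQ_inverse_real_of_nat by (simp add: inverse_eq_divide)
  from tendsto_add[OF tendsto_const this]
  show "(\<lambda>n. u + 1 / real (Suc n)) \<longlonglongrightarrow> u" by simp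
qed (use assms in \<open>auto intro!: always_eventually simp: grid_bounds simp del: of_nat_Suc\<close>)

text \<open>\<open>grid n\<close> has countably many values, so measurability of each single
  \<open>f s\<close> is enough; joint measurability in time and point is not assumed.\<close>

lemma measurable_grid_compose:
  fixes f :: "real \<Rightarrow> 'a \<Rightarrow> real"
  assumes "u \<in> borel_measurable N"
    and "\<And>s. 0 \<le> s \<Longrightarrow> f s \<in> borel_measurable N"
  shows "(\<lambda>x. f (grid n (u x)) x) \<in> borel_measurable N"
proof -
  have "(\<lambda>x. f ((real (nat \<lfloor>real (Suc n) * u x\<rfloor>) + 1) / real (Suc n)) x) \<in> borel_measurable N"
    by (rule measurable_compose_countable[where f = "\<lambda>k. f ((real k + 1) / real (Suc n))"])
      (use assms in measurable)
  then show ?thesis by (simp add: grid_def)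
qed

text \<open>The grid times approach \<open>u x\<close> from above, so right continuity along them
  exhibits the composition as a pointwise limit of measurable functions.\<close>

lemma measurable_right_continuous_compose:
  fixes f :: "real \<Rightarrow> 'a \<Rightarrow> real"
  assumes u: "u \<in> borel_measurable N" and u_ge: "\<And>x. x \<in> space N \<Longrightarrow> 0 \<le> u x"
    and f: "\<And>s. 0 \<le> s \<Longrightarrow> f s \<in> borel_measurable N"
    and lim: "\<And>x. x \<in> space N \<Longrightarrow> (\<lambda>n. f (grid n (u x)) x) \<longlonglongrightarrow> f (u x) x"
  shows "(\<lambda>x. f (u x) x) \<in> borel_measurable N"
  by (rule borel_measurable_LIMSEQ_real[OF lim measurable_grid_compose[OF u f]])

lemma measurable_continuous_at_random_time:
  fixes X :: "real \<Rightarrow> 'a \<Rightarrow> real"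
  assumes X: "\<And>t. t0 \<le> t \<Longrightarrow> X t \<in> borel_measurable M"
    and cont: "\<And>\<omega>. \<omega> \<in> space M \<Longrightarrow> continuous_on {t0..} (\<lambda>t. X t \<omega>)"
    and R: "R \<in> borel_measurable M" "\<And>\<omega>. \<omega> \<in> space M \<Longrightarrow> t0 \<le> R \<omega>"
  shows "(\<lambda>\<omega>. X (R \<omega>) \<omega>) \<in> borel_measurable M"
proof -
  \<comment> \<open>Only the elapsed time \<open>R \<omega> - t0\<close> is discretized: it is
    nonnegative, and the approximating times stay in \<open>{t0..}\<close>, where the path is
    continuous.\<close>
  have "(\<lambda>\<omega>. X (t0 + (R \<omega> - t0)) \<omega>) \<in> borel_measurable M"
  proof (rule measurable_right_continuous_compose[where f = "\<lambda>s. X (t0 + s)"])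
    fix \<omega> assume \<omega>: "\<omega> \<in> space M"
    then have "0 \<le> R \<omega> - t0" using R by auto
    then show "(\<lambda>n. X (t0 + grid n (R \<omega> - t0)) \<omega>) \<longlonglongrightarrow> X (t0 + (R \<omega> - t0)) \<omega>"
      by (intro continuous_on_tendsto_compose[OF cont[OF \<omega>]] tendsto_intros grid_tendsto)
        (auto intro!: always_eventually less_imp_le grid_pos)
  qed (use X R in auto)
  then show ?thesis by simp
qed

section \<open>Probabilities as integrals of indicators\<close>

text \<open>The factor \<open>indicator (space M)\<close> gives the integrand the shape it has in
  \<open>strong_markov_integral\<close> when the conditioning event is the whole space.\<close>

lemma integral_indicator_compose:
  "(\<integral>\<omega>. (indicator (space M) \<omega> * indicator B (Z \<omega>) :: real) \<partial>M) = measure M (Z -` B \<inter> space M)"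
proof -
  have "(\<integral>\<omega>. (indicator (space M) \<omega> * indicator B (Z \<omega>) :: real) \<partial>M) = (\<integral>\<omega>. indicator (Z -` B) \<omega> \<partial>M)"
    by (rule Bochner_Integration.integral_cong) (auto simp: indicator_def)
  then show ?thesis by simp
qed

text \<open>The indicator of \<open>{..c}\<close> is continuous except at \<open>c\<close>, a value
  that \<open>Z\<close> almost surely avoids. So the integrands converge almost everywhere, and the
  constant 1 dominates them.\<close>

lemma (in finite_measure) integral_indicator_atMost_tendsto:
  fixes Z :: "'a \<Rightarrow> real"
  assumes Zn: "\<And>n. Zn n \<in> borel_measurable M"
    and lim: "\<And>\<omega>. \<omega> \<in> space M \<Longrightarrow> \<omega> \<in> A \<Longrightarrow> (\<lambda>n. Zn n \<omega>) \<longlonglongrightarrow> Z \<omega>"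
    and Z: "Z \<in> borel_measurable M"
    and A: "A \<in> sets M" and no_atom: "AE \<omega> in M. Z \<omega> \<noteq> c"
  shows "(\<lambda>n. \<integral>\<omega>. (indicator A \<omega> * indicator {..c} (Zn n \<omega>) :: real) \<partial>M)
    \<longlonglongrightarrow> (\<integral>\<omega>. indicator A \<omega> * indicator {..c} (Z \<omega>) \<partial>M)"
proof (rule integral_dominated_convergence[where w = "\<lambda>_. 1"])
  show "AE \<omega> in M. (\<lambda>n. indicator A \<omega> * indicator {..c} (Zn n \<omega>))
    \<longlonglongrightarrow> (indicator A \<omega> * indicator {..c} (Z \<omega>) :: real)"
    using no_atom
  proof eventually_elim
    case (elim \<omega>)
    then consider "\<omega> \<notin> A \<or> \<omega> \<notin> space M" | "\<omega> \<in> A" "\<omega> \<in> space M" "Z \<omega> < c"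
      | "\<omega> \<in> A" "\<omega> \<in> space M" "c < Z \<omega>" by linarith
    then show ?case
    proof cases
      case 1
      then show ?thesis using sets.sets_into_space[OF A] by (auto simp: indicator_def)
    next
      case 2
      then have "\<forall>\<^sub>F n in sequentially. Zn n \<omega> < c"
        using lim order_tendstoD(2) by blast
      then have "\<forall>\<^sub>F n in sequentially. indicator A \<omega> * indicator {..c} (Zn n \<omega>) = (1 :: real)"
        by eventually_elim (use 2 in \<open>auto simp: indicator_def\<close>)
      then show ?thesis using 2 by (auto simp: indicator_def intro: tendsto_eventually)
    next
      case 3
      then have "\<forall>\<^sub>F n in sequentially. c < Zn n \<omega>"
        using lim order_tendstoD(1) by blast
      then have "\<forall>\<^sub>F n in sequentially. indicator A \<omega> * indicator {..c} (Zn n \<omega>) = (0 :: real)"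
        by eventually_elim (use 3 in \<open>auto simp: indicator_def\<close>)
      then show ?thesis using 3 by (auto simp: indicator_def intro: tendsto_eventually)
    qed
  qed
qed (use Zn Z A in \<open>auto simp: indicator_def\<close>)

section \<open>The natural filtration and the past of a stopping time\<close>

lemma sets_natural_filtration_subset:
  assumes "\<And>t. t0 \<le> t \<Longrightarrow> X t \<in> borel_measurable M"
  shows "sets (natural_filtration M t0 X t) \<subseteq> sets M"
proof -
  have "(\<Union>s\<in>{t0..t}. {X s -` B \<inter> space M | B. B \<in> sets borel}) \<subseteq> sets M"
    using assms by (auto intro: measurable_sets)
  then show ?thesis
    unfolding natural_filtration_def
    by (subst sets_measure_of) (use sets.sigma_sets_subset in blast)+
qed

lemma space_natural_filtration: "space (natural_filtration M t0 X t) = space M"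
  using filtration.space_F[OF filtration_natural_filtration] .

lemma measurable_natural_filtration:
  assumes "t0 \<le> s" "s \<le> t"
  shows "X s \<in> borel_measurable (natural_filtration M t0 X t)"
proof (rule measurableI)
  fix B :: "real set" assume "B \<in> sets borel"
  then show "X s -` B \<inter> space (natural_filtration M t0 X t) \<in> sets (natural_filtration M t0 X t)"
    unfolding space_natural_filtration using assms
    by (subst natural_filtration_def, subst sets_measure_of)
      (use \<open>B \<in> sets borel\<close> in \<open>auto intro!: sigma_sets.Basic bexI[of _ s] exI[of _ B]\<close>)
qed auto

text \<open>Since \<open>T\<close> is real-valued, an event \<open>A\<close> of the past is the
  union over \<open>n\<close> of its parts with \<open>T \<omega> \<le> real n\<close>, and each
  part belongs to \<open>F (real n)\<close>.\<close>

lemma subalgebra_pre_sigma: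
  fixes F :: "real \<Rightarrow> 'a measure"
  assumes "filtration (space M) F" and T: "stopping_time F T"
    and sub: "\<And>t. sets (F t) \<subseteq> sets M"
  shows "subalgebra M (filtration.pre_sigma (space M) F T)"
proof -
  interpret filtration "space M" F by fact
  have "A \<in> sets M" if A: "A \<in> sets (pre_sigma T)" for A
  proof -
    have "{\<omega> \<in> A. T \<omega> \<le> real n} \<in> sets M" for n
      using sets_pre_sigmaD[OF T A] sub by auto
    then have "(\<Union>n. {\<omega> \<in> A. T \<omega> \<le> real n}) \<in> sets M" by auto
    also have "(\<Union>n. {\<omega> \<in> A. T \<omega> \<le> real n}) = A"
      using real_arch_simple by auto
    finally show ?thesis .
  qed
  then show ?thesis by (auto simp: subalgebra_def space_pre_sigma)
qed

section \<open>A single diffusion and its one-dimensional laws\<close>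

context
  fixes M :: "'a measure" and t0 X I p x0
  assumes D: "diffusion_process M t0 X I p x0"
    and kernel: "\<And>s. 0 \<le> s \<Longrightarrow> p s \<in> restrict_space borel I \<rightarrow>\<^sub>M prob_algebra borel"
begin

interpretation prob_space M
  using D by (simp add: diffusion_process_def)

interpretation filtration "space M" "natural_filtration M t0 X"
  by (rule filtration_natural_filtration)

lemma kernel_prob: "0 \<le> s \<Longrightarrow> y \<in> I \<Longrightarrow> prob_space (p s y)"
  and kernel_sets: "0 \<le> s \<Longrightarrow> y \<in> I \<Longrightarrow> sets (p s y) = sets borel"
  using measurable_space[OF kernel, of s y]
  by (auto simp: space_prob_algebra space_restrict_space)

lemma diffusion_prob_space: "prob_space M" by unfold_locales

lemma diffusion_measurable: "t0 \<le> t \<Longrightarrow> X t \<in> borel_measurable M"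
  using D by (simp add: diffusion_process_def)

lemma diffusion_continuous: "\<omega> \<in> space M \<Longrightarrow> continuous_on {t0..} (\<lambda>t. X t \<omega>)"
  using D by (simp add: diffusion_process_def)

lemma diffusion_mem: "\<omega> \<in> space M \<Longrightarrow> t0 \<le> t \<Longrightarrow> X t \<omega> \<in> I"
  using D by (simp add: diffusion_process_def)

lemma diffusion_start: "AE \<omega> in M. X t0 \<omega> = x0"
  using D by (simp add: diffusion_process_def)

text \<open>A condition independent of \<open>\<omega>\<close> that holds almost surely on a
  probability space is true; here it is inherited from the paths, which stay in
  \<open>I\<close>.\<close>

lemma diffusion_start_mem: "x0 \<in> I"
proof -
  have "AE \<omega> in M. x0 \<in> I"
    using diffusion_start AE_space
    by eventually_elim (use diffusion_mem in auto)
  then show ?thesis by simp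
qed

lemma diffusion_stopping_time_measurable:
  "stopping_time (natural_filtration M t0 X) T \<Longrightarrow> T \<in> borel_measurable M"
  by (rule measurable_stopping_time[where F = "natural_filtration M t0 X"])
    (auto simp: space_natural_filtration intro!: sets_natural_filtration_subset diffusion_measurable
      dest: subsetD[rotated])

lemma diffusion_measurable_random_time:
  assumes "R \<in> borel_measurable M" "\<And>\<omega>. \<omega> \<in> space M \<Longrightarrow> t0 \<le> R \<omega>"
  shows "(\<lambda>\<omega>. X (R \<omega>) \<omega>) \<in> borel_measurable M"
  using measurable_continuous_at_random_time[of t0 X M R]
    diffusion_measurable diffusion_continuous assms by blast

text \<open>The integrated form of the strong Markov property: the defining property of conditional
  expectation, applied to an event \<open>A\<close> of the past of \<open>T\<close>.\<close>

lemma strong_markov_integral: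
  assumes T: "stopping_time (natural_filtration M t0 X) T" "\<And>\<omega>. \<omega> \<in> space M \<Longrightarrow> t0 \<le> T \<omega>"
    and A: "A \<in> sets (pre_sigma T)" and s: "0 \<le> s" and B: "B \<in> sets borel"
  shows "integrable M (\<lambda>\<omega>. indicator A \<omega> * measure (p s (X (T \<omega>) \<omega>)) B)" (is ?int)
    and "(\<integral>\<omega>. indicator A \<omega> * indicator B (X (T \<omega> + s) \<omega>) \<partial>M)
      = (\<integral>\<omega>. indicator A \<omega> * measure (p s (X (T \<omega>) \<omega>)) B \<partial>M)" (is ?eq)
proof -
  let ?F = "pre_sigma T"
  let ?C = "{\<omega> \<in> space M. X (T \<omega> + s) \<omega> \<in> B}"
  have sub: "subalgebra M ?F"
    by (rule subalgebra_pre_sigma[OF filtration_natural_filtration T(1)])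
      (use sets_natural_filtration_subset diffusion_measurable in blast)
  interpret finite_measure_subalgebra M ?F
    by unfold_locales (rule sub)
  have AE: "AE \<omega> in M. real_cond_exp M ?F (indicator ?C) \<omega> = measure (p s (X (T \<omega>) \<omega>)) B"
    using D T s B unfolding diffusion_process_def strong_markov_def by blast
  have [measurable]: "A \<in> sets M" using A sub by (auto simp: subalgebra_def)
  have "(\<lambda>\<omega>. X (T \<omega> + s) \<omega>) \<in> borel_measurable M"
    by (rule diffusion_measurable_random_time)
      (use diffusion_stopping_time_measurable[OF T(1)] T(2) s in \<open>auto intro: add_increasing2\<close>)
  from measurable_sets[OF this B] have C[measurable]: "?C \<in> sets M"
    by (simp add: vimage_def Int_def conj_commute)
  have intC: "integrable M (indicator ?C :: 'a \<Rightarrow> real)"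
    by (simp add: emeasure_eq_measure)
  \<comment> \<open>The kernel \<open>p s\<close> is measurable only on \<open>I\<close>, so
    \<open>X\<close> at time \<open>T\<close> has to be a random element of the restricted
    space.\<close>
  have [measurable]: "(\<lambda>\<omega>. X (T \<omega>) \<omega>) \<in> M \<rightarrow>\<^sub>M restrict_space borel I"
    using diffusion_measurable_random_time[of T] diffusion_stopping_time_measurable[OF T(1)] T(2) diffusion_mem
    by (intro measurable_restrict_space2) auto
  note B[measurable] kernel[OF s, THEN measurable_prob_algebraD, measurable]
  have [measurable]: "(\<lambda>\<omega>. measure (p s (X (T \<omega>) \<omega>)) B) \<in> borel_measurable M"
    by measurable
  show ?int
  proof (rule integrable_const_bound[where B = 1])
    have "measure (p s (X (T \<omega>) \<omega>)) B \<le> 1" if "\<omega> \<in> space M" for \<omega>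
      using kernel_prob[OF s diffusion_mem[OF that T(2)[OF that]]] by (rule prob_space.prob_le_1)
    then show "AE \<omega> in M. norm (indicator A \<omega> * measure (p s (X (T \<omega>) \<omega>)) B) \<le> 1"
      by (auto intro!: AE_I2 simp: indicator_def)
  qed measurable
  have [measurable]: "real_cond_exp M ?F (indicator ?C) \<in> borel_measurable M"
    by simp
  have 1: "AE \<omega> in M. indicator A \<omega> * real_cond_exp M ?F (indicator ?C) \<omega>
      = indicator A \<omega> * measure (p s (X (T \<omega>) \<omega>)) B"
    using AE by eventually_elim simp
  have "(\<integral>\<omega>. indicator A \<omega> * indicator B (X (T \<omega> + s) \<omega>) \<partial>M)
    = (\<integral>\<omega>. indicator A \<omega> * indicator ?C \<omega> \<partial>M)"
    by (rule Bochner_Integration.integral_cong) (auto simp: indicator_def)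
  also have "\<dots> = (\<integral>\<omega>. indicator A \<omega> * real_cond_exp M ?F (indicator ?C) \<omega> \<partial>M)"
    using real_cond_exp_intA[OF intC A] by (simp add: set_lebesgue_integral_def)
  also have "\<dots> = (\<integral>\<omega>. indicator A \<omega> * measure (p s (X (T \<omega>) \<omega>)) B \<partial>M)"
    by (rule integral_cong_AE[OF _ _ 1]) measurable
  finally show ?eq .
qed

text \<open>This is the Markov property at the constant time \<open>t0\<close>, conditioned on the
  whole space, where the starting state is almost surely \<open>x0\<close>.\<close>

lemma diffusion_law:
  assumes t: "t0 \<le> t"
  shows "distr M borel (X t) = p (t - t0) x0"
proof (rule measure_eqI)
  interpret P: prob_space "p (t - t0) x0"
    using t diffusion_start_mem by (intro kernel_prob) auto
  interpret N: prob_space "distr M borel (X t)"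
    by (rule prob_space_distr[OF diffusion_measurable[OF t]])
  show "sets (distr M borel (X t)) = sets (p (t - t0) x0)"
    using t diffusion_start_mem by (simp add: kernel_sets)
  fix B assume "B \<in> sets (distr M borel (X t))"
  then have [measurable]: "B \<in> sets borel" by simp
  note [measurable] = diffusion_measurable[OF t]
  have T: "stopping_time (natural_filtration M t0 X) (\<lambda>_. t0)"
    by (rule stopping_time_const)
  have "space M \<in> sets (pre_sigma (\<lambda>_. t0))"
    using sets.top[of "pre_sigma (\<lambda>_. t0)"] by (simp add: space_pre_sigma)
  from strong_markov_integral[OF T _ this, of "t - t0" B] t
  have *: "(\<integral>\<omega>. indicator (space M) \<omega> * indicator B (X t \<omega>) \<partial>M)
      = (\<integral>\<omega>. indicator (space M) \<omega> * measure (p (t - t0) (X t0 \<omega>)) B \<partial>M)"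
    and "integrable M (\<lambda>\<omega>. indicator (space M) \<omega> * measure (p (t - t0) (X t0 \<omega>)) B)"
    by auto
  note [measurable] = borel_measurable_integrable[OF this(2)]
  have "measure (distr M borel (X t)) B = (\<integral>\<omega>. indicator (space M) \<omega> * indicator B (X t \<omega>) \<partial>M)"
    by (simp add: measure_distr integral_indicator_compose)
  also have "\<dots> = (\<integral>\<omega>. measure (p (t - t0) x0) B \<partial>M)"
    unfolding * by (rule integral_cong_AE) (use diffusion_start in auto)
  finally have "measure (distr M borel (X t)) B = measure (p (t - t0) x0) B"
    by (simp add: prob_space)
  with N.emeasure_eq_measure P.emeasure_eq_measure show "emeasure (distr M borel (X t)) B = emeasure (p (t - t0) x0) B"
    by simp
qed

lemma diffusion_cdf:
  assumes t: "t0 \<le> t"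
  shows "cdf (p (t - t0) x0) c
    = (\<integral>\<omega>. indicator (space M) \<omega> * indicator {..c} (X t \<omega>) \<partial>M)"
proof -
  note [measurable] = diffusion_measurable[OF t]
  have "cdf (p (t - t0) x0) c = measure M (X t -` {..c} \<inter> space M)"
    unfolding diffusion_law[OF t, symmetric] cdf_def by (subst measure_distr) auto
  also have "\<dots> = (\<integral>\<omega>. indicator (space M) \<omega> * indicator {..c} (X t \<omega>) \<partial>M)"
    by (simp add: integral_indicator_compose)
  finally show ?thesis .
qed

lemma diffusion_no_atom:
  assumes t: "t0 \<le> t" and no_atom: "emeasure (p (t - t0) x0) {c} = 0"
  shows "AE \<omega> in M. X t \<omega> \<noteq> c"
proof -
  note [measurable] = diffusion_measurable[OF t]
  have "AE x in distr M borel (X t). x \<noteq> c"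
    unfolding diffusion_law[OF t]
    by (rule AE_I[of _ _ "{c}"]) (use t no_atom in \<open>auto simp: kernel_sets diffusion_start_mem\<close>)
  then show ?thesis
    by (subst (asm) AE_distr_iff) auto
qed

end

section \<open>Regularity of the transition function in time and state\<close>

context
  fixes r1 r2 :: ereal and p :: "real \<Rightarrow> real \<Rightarrow> real measure"
    and Q :: "real \<Rightarrow> 'b measure" and Y
  assumes family: "regular_diffusion_family r1 r2 p Q Y"
begin

lemma family_kernel: "0 \<le> s \<Longrightarrow> p s \<in> restrict_space borel (einterval r1 r2) \<rightarrow>\<^sub>M prob_algebra borel"
  using family by (simp add: regular_diffusion_family_def)

lemma family_prob: "0 \<le> s \<Longrightarrow> y \<in> einterval r1 r2 \<Longrightarrow> prob_space (p s y)"
  using measurable_space[OF family_kernel, of s y]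
  by (auto simp: space_prob_algebra space_restrict_space)

text \<open>At positive times the law has a Lebesgue density, and singletons are Lebesgue
  null.\<close>

lemma family_no_atom:
  assumes "0 < s" "y \<in> einterval r1 r2"
  shows "emeasure (p s y) {c} = 0"
proof -
  obtain f where f: "f \<in> borel_measurable borel" "p s y = density lborel (\<lambda>x. ennreal (f x))"
    using family assms unfolding regular_diffusion_family_def by blast
  have "AE x in lborel. x \<in> {c} \<longrightarrow> ennreal (f x) = 0"
    by (rule AE_I[of _ _ "{c}"]) auto
  then have "{c} \<in> null_sets (density lborel (\<lambda>x. ennreal (f x)))"
    by (subst null_sets_density_iff) (use f in auto)
  then show ?thesis using f(2) by auto
qed

text \<open>The family represents \<open>p v y\<close> as the law of \<open>Y v\<close> under
  \<open>Q y\<close>, which turns continuity in time into path continuity. Only the limit time must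
  be positive, since the absence of atoms is used there alone.\<close>

lemma family_cdf_tendsto:
  assumes y: "y \<in> einterval r1 r2" and s: "0 < s"
    and u: "\<And>n. 0 \<le> u n" "u \<longlonglongrightarrow> s"
  shows "(\<lambda>n. cdf (p (u n) y) c) \<longlonglongrightarrow> cdf (p s y) c"
proof -
  have D: "diffusion_process (Q y) 0 Y (einterval r1 r2) p y"
    using family y by (simp add: regular_diffusion_family_def)
  interpret prob_space "Q y"
    using D by (rule diffusion_prob_space[OF _ family_kernel])
  have eq: "cdf (p v y) c
      = (\<integral>\<omega>. indicator (space (Q y)) \<omega> * indicator {..c} (Y v \<omega>) \<partial>Q y)" if "0 \<le> v" for v
    using diffusion_cdf[OF D family_kernel that] by simp
  have "(\<lambda>n. \<integral>\<omega>. (indicator (space (Q y)) \<omega> * indicator {..c} (Y (u n) \<omega>) :: real) \<partial>Q y)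
    \<longlonglongrightarrow> (\<integral>\<omega>. indicator (space (Q y)) \<omega> * indicator {..c} (Y s \<omega>) \<partial>Q y)"
  proof (rule integral_indicator_atMost_tendsto)
    show "(\<lambda>n. Y (u n) \<omega>) \<longlonglongrightarrow> Y s \<omega>" if "\<omega> \<in> space (Q y)" for \<omega>
      by (rule continuous_on_tendsto_compose[OF diffusion_continuous[OF D family_kernel that] u(2)])
        (use u s in auto)
    show "AE \<omega> in Q y. Y s \<omega> \<noteq> c"
      by (rule diffusion_no_atom[OF D family_kernel]) (use s y in \<open>auto intro!: family_no_atom\<close>)
  qed (use u s in \<open>auto intro!: diffusion_measurable[OF D family_kernel]\<close>)
  then show ?thesis using u s by (simp add: eq)
qed

lemma measurable_cdf_fixed_time:
  assumes y: "y \<in> N \<rightarrow>\<^sub>M restrict_space borel (einterval r1 r2)" and s: "0 \<le> s"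
  shows "(\<lambda>x. cdf (p s (y x)) c) \<in> borel_measurable N"
proof -
  note [measurable] = y family_kernel[OF s, THEN measurable_prob_algebraD]
  show ?thesis unfolding cdf_def by measurable
qed

text \<open>The default value 0 removes the times at which the limit argument fails: the law at time
  0 may have an atom at \<open>c\<close>, and nothing is known about \<open>p\<close> at negative
  times.\<close>

lemma measurable_cdf_compose:
  assumes y: "y \<in> N \<rightarrow>\<^sub>M restrict_space borel (einterval r1 r2)"
    and u: "u \<in> borel_measurable N"
  shows "(\<lambda>x. if 0 < u x then cdf (p (u x) (y x)) c else 0) \<in> borel_measurable N"
proof (rule borel_measurable_LIMSEQ_real)
  show "(\<lambda>n. if 0 < u x then cdf (p (grid n (u x)) (y x)) c else 0)
      \<longlonglongrightarrow> (if 0 < u x then cdf (p (u x) (y x)) c else 0)" if "x \<in> space N" for x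
    using measurable_space[OF y that]
    by (auto intro!: family_cdf_tendsto grid_tendsto less_imp_le[OF grid_pos] simp: space_restrict_space)
  show "(\<lambda>x. if 0 < u x then cdf (p (grid n (u x)) (y x)) c else 0) \<in> borel_measurable N" for n
  proof -
    have [measurable]: "(\<lambda>x. cdf (p (grid n (u x)) (y x)) c) \<in> borel_measurable N"
      by (rule measurable_grid_compose[OF u measurable_cdf_fixed_time[OF y]])
    note [measurable] = u
    show ?thesis by measurable
  qed
qed

lemma cdf_bounds:
  assumes "0 \<le> s" "y \<in> einterval r1 r2"
  shows "0 \<le> cdf (p s y) c" "cdf (p s y) c \<le> 1"
  using prob_space.prob_le_1[OF family_prob[OF assms]] by (auto simp: cdf_def)

end

section \<open>The Markov property after a random delay\<close>

text \<open>
  The strong Markov property gives the law of \<open>X\<close> only a deterministic time after \<open>T\<close>. It is applied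
  on each event where \<open>grid n (t - T)\<close> has a given value; then \<open>n \<rightarrow> \<infinity>\<close>.
\<close>

lemma markov_remaining_time:
  fixes X :: "real \<Rightarrow> 'a \<Rightarrow> real"
  assumes family: "regular_diffusion_family r1 r2 p Q Y"
    and D: "diffusion_process M t0 X (einterval r1 r2) p x0"
    and T: "stopping_time (natural_filtration M t0 X) T" "\<And>\<omega>. \<omega> \<in> space M \<Longrightarrow> t0 \<le> T \<omega>"
    and t: "t0 < t"
  defines "A \<equiv> {\<omega> \<in> space M. T \<omega> < t}"
  shows "(\<integral>\<omega>. indicator A \<omega> * indicator {..c} (X t \<omega>) \<partial>M)
    = (\<integral>\<omega>. indicator A \<omega> * cdf (p (t - T \<omega>) (X (T \<omega>) \<omega>)) c \<partial>M)"
proof -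
  note K = family_kernel[OF family]
  interpret prob_space M
    using diffusion_prob_space[OF D K] by simp
  interpret filtration "space M" "natural_filtration M t0 X"
    by (rule filtration_natural_filtration)
  note [measurable] = diffusion_stopping_time_measurable[OF D K T(1), simplified]
  have XT[measurable]: "(\<lambda>\<omega>. X (T \<omega>) \<omega>) \<in> M \<rightarrow>\<^sub>M restrict_space borel (einterval r1 r2)"
    using diffusion_measurable_random_time[OF D K, of T] T(2) diffusion_mem[OF D K]
    by (intro measurable_restrict_space2) auto
  have XT_mem: "X (T \<omega>) \<omega> \<in> einterval r1 r2" if "\<omega> \<in> space M" for \<omega>
    using diffusion_mem[OF D K that T(2)[OF that]] by simp
  have Xr[measurable]: "(\<lambda>\<omega>. X (T \<omega> + grid n (t - T \<omega>)) \<omega>) \<in> borel_measurable M" for n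
  proof (rule diffusion_measurable_random_time[OF D K])
    show "(\<lambda>\<omega>. T \<omega> + grid n (t - T \<omega>)) \<in> borel_measurable M"
      unfolding grid_def by measurable
  qed (use T(2) in \<open>auto intro!: add_increasing2 less_imp_le[OF grid_pos]\<close>)
  have [measurable]: "A \<in> sets M"
    unfolding A_def by measurable
  have grid_step: "(\<integral>\<omega>. indicator A \<omega> * indicator {..c} (X (T \<omega> + grid n (t - T \<omega>)) \<omega>) \<partial>M)
    = (\<integral>\<omega>. indicator A \<omega> * cdf (p (grid n (t - T \<omega>)) (X (T \<omega>) \<omega>)) c \<partial>M)" for n
  proof -
    define k where "k \<omega> = nat \<lfloor>real (Suc n) * (t - T \<omega>)\<rfloor>" for \<omega>
    define m where "m = nat \<lfloor>real (Suc n) * (t - t0)\<rfloor>"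
    define s where "s j = (real j + 1) / real (Suc n)" for j
    define B where "B j = {\<omega> \<in> A. k \<omega> = j}" for j
    have grid_eq: "grid n (t - T \<omega>) = s (k \<omega>)" for \<omega>
      by (simp add: grid_def k_def s_def)
    \<comment> \<open>From \<open>T \<omega> \<ge> t0\<close> the remaining time is at most
      \<open>t - t0\<close>, so only the finitely many cells up to \<open>m\<close> occur and the
      decomposition is a finite sum.\<close>
    have k_le: "k \<omega> \<le> m" if "\<omega> \<in> A" for \<omega>
      unfolding k_def m_def using T(2)[of \<omega>] that
      by (intro nat_mono floor_mono mult_left_mono) (auto simp: A_def)
    \<comment> \<open>Stated for a general \<open>f\<close> because it serves twice: for the
      indicator of the future state and for the transition distribution function.\<close>
    have split: "indicator A \<omega> * f \<omega> (grid n (t - T \<omega>)) = (\<Sum>j\<le>m. indicator (B j) \<omega> * f \<omega> (s j))"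
      for \<omega> and f :: "'a \<Rightarrow> real \<Rightarrow> real"
    proof (cases "\<omega> \<in> A")
      case True
      have "(\<Sum>j\<le>m. indicator (B j) \<omega> * f \<omega> (s j)) = (\<Sum>j\<le>m. if k \<omega> = j then f \<omega> (s j) else 0)"
        using True by (intro sum.cong) (auto simp: B_def)
      also have "\<dots> = f \<omega> (s (k \<omega>))"
        using k_le[OF True] by (subst sum.delta') auto
      finally show ?thesis using True by (simp add: grid_eq)
    qed (simp add: B_def)
    have s: "0 \<le> s j" for j by (simp add: s_def)
    \<comment> \<open>The cell is described by the value of \<open>T\<close> alone, and
      \<open>T\<close> is measurable with respect to its own past.\<close>
    have B: "B j \<in> sets (pre_sigma T)" for j
    proof -
      note [measurable] = measurable_stopping_time_pre_sigma[OF T(1)]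
      have "B j = {\<omega> \<in> space (pre_sigma T). T \<omega> < t \<and> nat \<lfloor>real (Suc n) * (t - T \<omega>)\<rfloor> = j}"
        by (auto simp: B_def A_def k_def space_pre_sigma)
      also have "\<dots> \<in> sets (pre_sigma T)" by measurable
      finally show ?thesis .
    qed
    have [measurable]: "B j \<in> sets M" for j
      unfolding B_def k_def A_def by measurable
    have [measurable]: "(\<lambda>\<omega>. X (T \<omega> + s j) \<omega>) \<in> borel_measurable M" for j
      by (rule diffusion_measurable_random_time[OF D K]) (use T(2) s in \<open>auto intro!: add_increasing2\<close>)
    note sm = strong_markov_integral[OF D K T B s, where B = "{..c}", simplified]
    have "(\<integral>\<omega>. (indicator A \<omega> * indicator {..c} (X (T \<omega> + grid n (t - T \<omega>)) \<omega>) :: real) \<partial>M)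
      = (\<integral>\<omega>. (\<Sum>j\<le>m. indicator (B j) \<omega> * indicator {..c} (X (T \<omega> + s j) \<omega>)) \<partial>M)"
      by (intro Bochner_Integration.integral_cong refl
          split[of _ "\<lambda>\<omega> v. indicator {..c} (X (T \<omega> + v) \<omega>)"])
    also have "\<dots> = (\<Sum>j\<le>m. \<integral>\<omega>. indicator (B j) \<omega> * indicator {..c} (X (T \<omega> + s j) \<omega>) \<partial>M)"
      by (rule Bochner_Integration.integral_sum)
        (auto intro!: integrable_const_bound[where B = 1] simp: indicator_def)
    also have "\<dots> = (\<Sum>j\<le>m. \<integral>\<omega>. indicator (B j) \<omega> * cdf (p (s j) (X (T \<omega>) \<omega>)) c \<partial>M)"
      using sm(2) by (simp add: cdf_def)
    also have "\<dots> = (\<integral>\<omega>. (\<Sum>j\<le>m. indicator (B j) \<omega> * cdf (p (s j) (X (T \<omega>) \<omega>)) c) \<partial>M)"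
      using sm(1) by (intro Bochner_Integration.integral_sum[symmetric]) (auto simp: cdf_def)
    also have "\<dots> = (\<integral>\<omega>. indicator A \<omega> * cdf (p (grid n (t - T \<omega>)) (X (T \<omega>) \<omega>)) c \<partial>M)"
      by (intro Bochner_Integration.integral_cong refl
          split[of _ "\<lambda>\<omega> v. cdf (p v (X (T \<omega>) \<omega>)) c", symmetric])
    finally show ?thesis .
  qed
  have "(\<lambda>n. \<integral>\<omega>. (indicator A \<omega> * indicator {..c} (X (T \<omega> + grid n (t - T \<omega>)) \<omega>) :: real) \<partial>M)
    \<longlonglongrightarrow> (\<integral>\<omega>. indicator A \<omega> * indicator {..c} (X t \<omega>) \<partial>M)"
  proof (rule integral_indicator_atMost_tendsto)
    fix \<omega> assume \<omega>: "\<omega> \<in> space M" "\<omega> \<in> A"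
    then have "(\<lambda>n. T \<omega> + grid n (t - T \<omega>)) \<longlonglongrightarrow> T \<omega> + (t - T \<omega>)"
      by (intro tendsto_intros grid_tendsto) (auto simp: A_def)
    then show "(\<lambda>n. X (T \<omega> + grid n (t - T \<omega>)) \<omega>) \<longlonglongrightarrow> X t \<omega>"
      using t T(2)[OF \<omega>(1)]
      by (intro continuous_on_tendsto_compose[OF diffusion_continuous[OF D K \<omega>(1)]])
        (auto intro!: always_eventually add_increasing2 less_imp_le[OF grid_pos])
  next
    show "AE \<omega> in M. X t \<omega> \<noteq> c"
      using t diffusion_start_mem[OF D K]
      by (intro diffusion_no_atom[OF D K]) (auto intro!: family_no_atom[OF family])
  qed (use t diffusion_measurable[OF D K] in auto)
  \<comment> \<open>On \<open>A\<close> the limiting delay \<open>t - T \<omega>\<close> is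
    positive, where the distribution function is continuous in time; off \<open>A\<close> all
    integrands vanish.\<close>
  moreover have "(\<lambda>n. \<integral>\<omega>. indicator A \<omega> * cdf (p (grid n (t - T \<omega>)) (X (T \<omega>) \<omega>)) c \<partial>M)
    \<longlonglongrightarrow> (\<integral>\<omega>. indicator A \<omega> * cdf (p (t - T \<omega>) (X (T \<omega>) \<omega>)) c \<partial>M)"
  proof (rule integral_dominated_convergence[where w = "\<lambda>_. 1"])
    have "(\<lambda>\<omega>. if 0 < t - T \<omega> then cdf (p (t - T \<omega>) (X (T \<omega>) \<omega>)) c else 0) \<in> borel_measurable M"
      by (rule measurable_cdf_compose[OF family XT]) measurable
    then show "(\<lambda>\<omega>. indicator A \<omega> * cdf (p (t - T \<omega>) (X (T \<omega>) \<omega>)) c) \<in> borel_measurable M"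
      by (rule measurable_cong[THEN iffD1, rotated]) (auto simp: A_def)
    have [measurable]: "(\<lambda>\<omega>. cdf (p (grid n (t - T \<omega>)) (X (T \<omega>) \<omega>)) c) \<in> borel_measurable M" for n
      by (rule measurable_grid_compose[where f = "\<lambda>s \<omega>. cdf (p s (X (T \<omega>) \<omega>)) c"])
        (measurable, rule measurable_cdf_fixed_time[OF family XT])
    show "(\<lambda>\<omega>. indicator A \<omega> * cdf (p (grid n (t - T \<omega>)) (X (T \<omega>) \<omega>)) c) \<in> borel_measurable M" for n
      by measurable
    show "AE \<omega> in M. (\<lambda>n. indicator A \<omega> * cdf (p (grid n (t - T \<omega>)) (X (T \<omega>) \<omega>)) c)
      \<longlonglongrightarrow> indicator A \<omega> * cdf (p (t - T \<omega>) (X (T \<omega>) \<omega>)) c"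
    proof (rule AE_I2)
      fix \<omega> assume "\<omega> \<in> space M"
      then show "(\<lambda>n. indicator A \<omega> * cdf (p (grid n (t - T \<omega>)) (X (T \<omega>) \<omega>)) c)
        \<longlonglongrightarrow> indicator A \<omega> * cdf (p (t - T \<omega>) (X (T \<omega>) \<omega>)) c"
        using XT_mem
        by (cases "\<omega> \<in> A")
          (auto simp: A_def intro!: family_cdf_tendsto[OF family] grid_tendsto less_imp_le[OF grid_pos])
    qed
    show "AE \<omega> in M. norm (indicator A \<omega> * cdf (p (grid n (t - T \<omega>)) (X (T \<omega>) \<omega>)) c) \<le> 1" for n
      using XT_mem cdf_bounds[OF family less_imp_le[OF grid_pos]]
      by (auto intro!: AE_I2 simp: indicator_def)
  qed auto
  ultimately show ?thesis
    unfolding grid_step by (rule LIMSEQ_unique)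
qed

section \<open>Hitting times of moving boundaries\<close>

text \<open>By continuity the set of meeting times is closed; it is bounded below by
  \<open>t0\<close>, so if it is nonempty its infimum is attained.\<close>

lemma hitting_time_cases:
  fixes X :: "real \<Rightarrow> 'a \<Rightarrow> real"
  assumes X: "continuous_on {t0..} (\<lambda>t. X t \<omega>)" and c: "continuous_on {t0..} c"
  obtains (never) "hitting_time t0 X c \<omega> = \<infinity>" "\<And>s. t0 \<le> s \<Longrightarrow> X s \<omega> \<noteq> c s"
    | (hit) s where "hitting_time t0 X c \<omega> = ereal s" "t0 \<le> s" "X s \<omega> = c s"
        "\<And>r. t0 \<le> r \<Longrightarrow> X r \<omega> = c r \<Longrightarrow> s \<le> r"
proof -
  define H where "H = {s. t0 \<le> s \<and> X s \<omega> = c s}"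
  show thesis
  proof (cases "H = {}")
    case True
    then have *: "{s. t0 \<le> s \<and> X s \<omega> = c s} = {}" by (simp add: H_def)
    show thesis
    proof (rule never)
      show "hitting_time t0 X c \<omega> = \<infinity>"
        unfolding hitting_time_def * by (simp add: top_ereal_def)
    qed (use * in blast)
  next
    case False
    have "closed ({t0..} \<inter> (\<lambda>s. X s \<omega> - c s) -` {0})"
      by (intro continuous_closed_preimage continuous_intros X c closed_atLeast closed_singleton)
    also have "{t0..} \<inter> (\<lambda>s. X s \<omega> - c s) -` {0} = H"
      by (auto simp: H_def)
    finally have "closed H" .
    have bdd: "bdd_below H" by (auto simp: H_def bdd_below_def)
    have "Inf H \<in> H"
      by (rule closed_contains_Inf) (use False bdd \<open>closed H\<close> in auto)
    moreover have "hitting_time t0 X c \<omega> = ereal (Inf H)"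
      unfolding hitting_time_def H_def[symmetric] by (rule ereal_Inf'[OF bdd False, symmetric])
    moreover have "Inf H \<le> r" if "t0 \<le> r" "X r \<omega> = c r" for r
      using that bdd by (auto intro!: cInf_lower simp: H_def)
    ultimately show thesis by (intro hit[of "Inf H"]) (auto simp: H_def)
  qed
qed

lemma hitting_time_ge: "ereal t0 \<le> hitting_time t0 X c \<omega>"
  by (auto simp: hitting_time_def intro!: Inf_greatest)

lemma hitting_time_gt_MInf: "hitting_time t0 X c \<omega> \<noteq> - \<infinity>"
  using hitting_time_ge[of t0 X c \<omega>] by auto

lemma hitting_time_le_iff:
  fixes X :: "real \<Rightarrow> 'a \<Rightarrow> real"
  assumes X: "continuous_on {t0..} (\<lambda>t. X t \<omega>)" and c: "continuous_on {t0..} c"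
  shows "hitting_time t0 X c \<omega> \<le> ereal t \<longleftrightarrow> (\<exists>s\<in>{t0..t}. X s \<omega> = c s)"
  by (rule hitting_time_cases[where X = X and \<omega> = \<omega>, OF X c]) force+

lemma hitting_time_attained:
  fixes X :: "real \<Rightarrow> 'a \<Rightarrow> real"
  assumes X: "continuous_on {t0..} (\<lambda>t. X t \<omega>)" and c: "continuous_on {t0..} c"
    and "hitting_time t0 X c \<omega> = ereal s"
  shows "X s \<omega> = c s"
  by (rule hitting_time_cases[where X = X and \<omega> = \<omega>, OF X c]) (use assms(3) in auto)

text \<open>Values close to a zero are small at nearby points of \<open>D\<close>; conversely, by
  compactness a continuous function without zeros has its modulus bounded away from 0. This replaces
  an uncountable union over times by countable operations.\<close>

lemma exists_zero_iff_dense: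
  fixes h :: "real \<Rightarrow> real"
  assumes h: "continuous_on {u..v} h" and D: "D \<subseteq> {u..v}" "{u..v} \<subseteq> closure D"
  shows "(\<exists>s\<in>{u..v}. h s = 0) \<longleftrightarrow> (\<forall>n. \<exists>q\<in>D. \<bar>h q\<bar> < 1 / real (Suc n))"
proof
  assume "\<exists>s\<in>{u..v}. h s = 0"
  then obtain s where s: "s \<in> {u..v}" "h s = 0" by blast
  show "\<forall>n. \<exists>q\<in>D. \<bar>h q\<bar> < 1 / real (Suc n)"
  proof
    fix n
    obtain d where d: "0 < d" "\<And>q. q \<in> {u..v} \<Longrightarrow> dist q s < d \<Longrightarrow> dist (h q) (h s) < 1 / real (Suc n)"
      using h s(1) unfolding continuous_on_iff by (metis zero_less_divide_1_iff of_nat_0_less_iff zero_less_Suc)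
    obtain q where "q \<in> D" "dist q s < d"
      using D(2) s(1) d(1) by (meson closure_approachable subsetD)
    then show "\<exists>q\<in>D. \<bar>h q\<bar> < 1 / real (Suc n)"
      using d(2)[of q] D(1) s(2) by (intro bexI[of _ q]) (auto simp: dist_real_def)
  qed
next
  assume *: "\<forall>n. \<exists>q\<in>D. \<bar>h q\<bar> < 1 / real (Suc n)"
  \<comment> \<open>The minimum of the modulus exists only on a nonempty interval; a point of
    \<open>D\<close> provides one.\<close>
  then have "{u..v} \<noteq> {}" using D(1) by blast
  moreover have "continuous_on {u..v} (\<lambda>s. \<bar>h s\<bar>)"
    by (intro continuous_intros h)
  ultimately obtain s where s: "s \<in> {u..v}" "\<And>q. q \<in> {u..v} \<Longrightarrow> \<bar>h s\<bar> \<le> \<bar>h q\<bar>"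
    using continuous_attains_inf[OF compact_Icc, of u v "\<lambda>s. \<bar>h s\<bar>"] by blast
  have "h s = 0"
  proof (rule ccontr)
    assume "h s \<noteq> 0"
    then obtain n where "1 / real (Suc n) < \<bar>h s\<bar>"
      using reals_Archimedean[of "\<bar>h s\<bar>"] by (auto simp: inverse_eq_divide)
    moreover obtain q where "q \<in> D" "\<bar>h q\<bar> < 1 / real (Suc n)"
      using * by blast
    ultimately show False using s(2)[of q] D(1) by auto
  qed
  then show "\<exists>s\<in>{u..v}. h s = 0" using s(1) by blast
qed

text \<open>By density, whether the boundary is met up to \<open>t\<close> can be read off from the
  states at countably many times in \<open>{t0..t}\<close>, all observable at time
  \<open>t\<close>.\<close>

lemma hitting_time_le_natural_filtration:
  fixes X :: "real \<Rightarrow> 'a \<Rightarrow> real"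
  assumes X: "\<And>\<omega>. \<omega> \<in> space M \<Longrightarrow> continuous_on {t0..} (\<lambda>t. X t \<omega>)" and c: "continuous_on {t0..} c"
  shows "Measurable.pred (natural_filtration M t0 X t) (\<lambda>\<omega>. hitting_time t0 X c \<omega> \<le> ereal t)"
proof -
  obtain D where D: "countable D" "D \<subseteq> {t0..t}" "{t0..t} \<subseteq> closure D"
    using separable[of "{t0..t}"] by blast
  have iff: "hitting_time t0 X c \<omega> \<le> ereal t \<longleftrightarrow> (\<forall>n. \<exists>q\<in>D. \<bar>X q \<omega> - c q\<bar> < 1 / real (Suc n))"
    if "\<omega> \<in> space (natural_filtration M t0 X t)" for \<omega>
  proof -
    note that = that[unfolded space_natural_filtration]
    have "continuous_on {t0..t} (\<lambda>s. X s \<omega> - c s)"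
      by (intro continuous_intros continuous_on_subset[OF X[OF that]] continuous_on_subset[OF c]) auto
    from exists_zero_iff_dense[OF this D(2,3)] show ?thesis
      by (simp add: hitting_time_le_iff[where X = X and \<omega> = \<omega>, OF X[OF that] c])
  qed
  show ?thesis
  proof (rule measurable_cong[THEN iffD2, OF iff], assumption, intro pred_intros_countable(1) measurable_pred_countable(2) D(1))
    fix n q assume "q \<in> D"
    then have [measurable]: "X q \<in> borel_measurable (natural_filtration M t0 X t)"
      using D(2) by (intro measurable_natural_filtration) auto
    show "Measurable.pred (natural_filtration M t0 X t) (\<lambda>\<omega>. \<bar>X q \<omega> - c q\<bar> < 1 / real (Suc n))"
      by measurable
  qed
qed

lemma measurable_hitting_time:
  fixes X :: "real \<Rightarrow> 'a \<Rightarrow> real"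
  assumes X: "\<And>\<omega>. \<omega> \<in> space M \<Longrightarrow> continuous_on {t0..} (\<lambda>t. X t \<omega>)"
    and Xm: "\<And>t. t0 \<le> t \<Longrightarrow> X t \<in> borel_measurable M"
    and c: "continuous_on {t0..} c"
  shows "hitting_time t0 X c \<in> borel_measurable M"
proof (rule borel_measurableI_le)
  fix y :: ereal
  show "{\<omega> \<in> space M. hitting_time t0 X c \<omega> \<le> y} \<in> sets M"
  proof (cases y)
    case (real r)
    have "{\<omega> \<in> space M. hitting_time t0 X c \<omega> \<le> ereal r} \<in> sets (natural_filtration M t0 X r)"
      using hitting_time_le_natural_filtration[OF X c, where t = r] by (simp add: pred_def space_natural_filtration)
    then show ?thesis
      using sets_natural_filtration_subset[of t0 X M r] Xm real by auto
  next
    case MInf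
    then have "{\<omega> \<in> space M. hitting_time t0 X c \<omega> \<le> y} = {}"
      by (auto simp: hitting_time_gt_MInf)
    then show ?thesis by (simp only: sets.empty_sets)
  qed simp
qed

text \<open>Truncating at \<open>t\<close> makes the first exit time real-valued, as
  \<open>strong_markov\<close> requires, without changing anything on the event that the exit occurs
  before \<open>t\<close>.\<close>

lemma stopping_time_truncated_hitting_times:
  fixes X :: "real \<Rightarrow> 'a \<Rightarrow> real"
  assumes X: "\<And>\<omega>. \<omega> \<in> space M \<Longrightarrow> continuous_on {t0..} (\<lambda>t. X t \<omega>)"
    and a: "continuous_on {t0..} a" and b: "continuous_on {t0..} b"
  shows "stopping_time (natural_filtration M t0 X)
    (\<lambda>\<omega>. real_of_ereal (min (min (hitting_time t0 X a \<omega>) (hitting_time t0 X b \<omega>)) (ereal t)))"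
proof (rule stopping_timeI)
  fix u
  \<comment> \<open>Hitting times are at least \<open>t0\<close>, hence never minus infinity; the
    truncated minimum is therefore finite and \<open>real_of_ereal\<close> preserves it.\<close>
  have "real_of_ereal (min (min (hitting_time t0 X a \<omega>) (hitting_time t0 X b \<omega>)) (ereal t)) \<le> u
    \<longleftrightarrow> hitting_time t0 X a \<omega> \<le> ereal u \<or> hitting_time t0 X b \<omega> \<le> ereal u \<or> t \<le> u" for \<omega>
    using hitting_time_ge[of t0 X a \<omega>] hitting_time_ge[of t0 X b \<omega>]
    by (cases "hitting_time t0 X a \<omega>"; cases "hitting_time t0 X b \<omega>") (auto simp: min_def)
  moreover note [measurable] =
    hitting_time_le_natural_filtration[OF X a, where t = u] hitting_time_le_natural_filtration[OF X b, where t = u]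
  ultimately show "Measurable.pred (natural_filtration M t0 X u) (\<lambda>\<omega>. real_of_ereal
      (min (min (hitting_time t0 X a \<omega>) (hitting_time t0 X b \<omega>)) (ereal t)) \<le> u)"
    by simp
qed

section \<open>Expectations as integrals against a first hitting density\<close>

text \<open>On the event \<open>E\<close> the time \<open>T\<close> is finite and its law, a
  sub-probability, has density \<open>g\<close> on \<open>{t0..}\<close>. The claim is then the
  change of variables formula for this law.\<close>

lemma first_hit_density_integral:
  fixes h :: "real \<Rightarrow> real"
  assumes g: "first_hit_density M t0 T S g" and "finite_measure M"
    and T[measurable]: "T \<in> borel_measurable M" and S[measurable]: "S \<in> borel_measurable M"
    and T_ge: "\<And>\<omega>. ereal t0 \<le> T \<omega>"
    and h[measurable]: "h \<in> borel_measurable borel" and bound: "\<And>x. \<bar>h x\<bar> \<le> C"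
  defines "E \<equiv> {\<omega> \<in> space M. T \<omega> < S \<omega>}"
  shows "integrable lborel (\<lambda>x. indicator {t0..} x * g x * h x)"
    and "(\<integral>x. indicator {t0..} x * g x * h x \<partial>lborel)
      = (\<integral>\<omega>. indicator E \<omega> * h (real_of_ereal (T \<omega>)) \<partial>M)"
proof -
  interpret finite_measure M by fact
  have [measurable]: "E \<in> sets M" unfolding E_def by measurable
  then have E: "E \<inter> space M \<in> sets M" by (simp add: sets.Int)
  let ?g = "\<lambda>x. indicator {t0..} x * g x"
  have gm[measurable]: "?g \<in> borel_measurable lborel"
    using g by (simp add: first_hit_density_def set_borel_measurable_def)
  have g0: "AE x in lborel. 0 \<le> ?g x"
    using g by (auto simp: first_hit_density_def indicator_def)
  let ?N = "restrict_space M E"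
  have Tm[measurable]: "(\<lambda>\<omega>. real_of_ereal (T \<omega>)) \<in> borel_measurable ?N"
    by (rule measurable_restrict_space1) measurable
  have law: "distr ?N lborel (\<lambda>\<omega>. real_of_ereal (T \<omega>)) = density lborel (\<lambda>x. ennreal (?g x))"
  proof (rule measure_eqI)
    fix A assume "A \<in> sets (distr ?N lborel (\<lambda>\<omega>. real_of_ereal (T \<omega>)))"
    then have A[measurable]: "A \<in> sets borel" by simp
    \<comment> \<open>\<open>T \<omega> < S \<omega>\<close> excludes the value infinity and
      \<open>T_ge\<close> excludes minus infinity.\<close>
    have "T \<omega> \<in> ereal ` (A \<inter> {t0..}) \<longleftrightarrow> real_of_ereal (T \<omega>) \<in> A" if "T \<omega> < S \<omega>" for \<omega>
      using T_ge[of \<omega>] that by (cases "T \<omega>") (auto simp: image_iff)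
    then have eq: "(\<lambda>\<omega>. real_of_ereal (T \<omega>)) -` A \<inter> space ?N
        = {\<omega> \<in> space M. T \<omega> \<in> ereal ` (A \<inter> {t0..}) \<and> T \<omega> < S \<omega>}"
      by (auto simp: space_restrict_space E_def)
    have "emeasure (distr ?N lborel (\<lambda>\<omega>. real_of_ereal (T \<omega>))) A
      = emeasure ?N ((\<lambda>\<omega>. real_of_ereal (T \<omega>)) -` A \<inter> space ?N)"
      by (subst emeasure_distr) (use Tm in auto)
    also have "\<dots> = emeasure M ((\<lambda>\<omega>. real_of_ereal (T \<omega>)) -` A \<inter> space ?N)"
      by (subst emeasure_restrict_space) (use E in \<open>auto simp: space_restrict_space\<close>)
    also have "\<dots> = (\<integral>\<^sup>+x\<in>A \<inter> {t0..}. ennreal (g x) \<partial>lborel)"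
      unfolding eq using g by (auto simp: first_hit_density_def)
    also have "\<dots> = (\<integral>\<^sup>+x\<in>A. ennreal (?g x) \<partial>lborel)"
      by (rule nn_integral_cong) (auto simp: indicator_def)
    also have "\<dots> = emeasure (density lborel (\<lambda>x. ennreal (?g x))) A"
      by (rule emeasure_density[symmetric]) measurable
    finally show "emeasure (distr ?N lborel (\<lambda>\<omega>. real_of_ereal (T \<omega>))) A
      = emeasure (density lborel (\<lambda>x. ennreal (?g x))) A" .
  qed simp
  have "integrable M (\<lambda>\<omega>. indicator E \<omega> *\<^sub>R h (real_of_ereal (T \<omega>)))"
    by (rule integrable_const_bound[where B = "\<bar>C\<bar>"])
      (auto intro!: AE_I2 order_trans[OF bound] simp: indicator_def)
  then have "integrable ?N (\<lambda>\<omega>. h (real_of_ereal (T \<omega>)))"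
    by (subst integrable_restrict_space[OF E])
  then have "integrable (distr ?N lborel (\<lambda>\<omega>. real_of_ereal (T \<omega>))) h"
    by (subst integrable_distr_eq) (use Tm in auto)
  then show "integrable lborel (\<lambda>x. indicator {t0..} x * g x * h x)"
    unfolding law by (subst (asm) integrable_density[OF _ gm g0]) auto
  have "(\<integral>x. indicator {t0..} x * g x * h x \<partial>lborel) = integral\<^sup>L (density lborel (\<lambda>x. ennreal (?g x))) h"
    by (subst integral_density[OF _ gm g0]) auto
  also have "\<dots> = (\<integral>\<omega>. h (real_of_ereal (T \<omega>)) \<partial>?N)"
    unfolding law[symmetric] by (subst integral_distr) (use Tm in auto)
  also have "\<dots> = (\<integral>\<omega>. indicator E \<omega> * h (real_of_ereal (T \<omega>)) \<partial>M)"
    by (subst integral_restrict_space[OF E]) simp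
  finally show "(\<integral>x. indicator {t0..} x * g x * h x \<partial>lborel)
      = (\<integral>\<omega>. indicator E \<omega> * h (real_of_ereal (T \<omega>)) \<partial>M)" .
qed

text \<open>Adapts the previous formula to a kernel \<open>f\<close> controlled only on
  \<open>{t0..<t}\<close>: \<open>h\<close> is a bounded measurable function on the line that agrees
  with it there and is cut off at \<open>t\<close>.\<close>

lemma first_hit_density_set_integral:
  fixes h f :: "real \<Rightarrow> real"
  assumes g: "first_hit_density M t0 T S g" and fin: "finite_measure M"
    and T: "T \<in> borel_measurable M" and S: "S \<in> borel_measurable M"
    and T_ge: "\<And>\<omega>. ereal t0 \<le> T \<omega>"
    and h: "h \<in> borel_measurable borel" and bound: "\<And>x. \<bar>h x\<bar> \<le> C"
    and f: "\<And>x. t0 \<le> x \<Longrightarrow> x < t \<Longrightarrow> f x = h x" and h0: "\<And>x. t \<le> x \<Longrightarrow> h x = 0"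
    and t: "t0 \<le> t"
  defines "E \<equiv> {\<omega> \<in> space M. T \<omega> < S \<omega>}"
  shows "set_integrable lborel {t0..t} (\<lambda>x. f x * g x)"
    and "(LBINT x:{t0..t}. f x * g x) = (\<integral>\<omega>. indicator E \<omega> * h (real_of_ereal (T \<omega>)) \<partial>M)"
proof -
  note I = first_hit_density_integral[OF g fin T S T_ge h bound, folded E_def]
  \<comment> \<open>At the endpoint \<open>f t\<close> need not equal \<open>h t = 0\<close>. The
    correction lives on the single point \<open>t\<close>, so its integral is 0.\<close>
  have eq: "(\<lambda>x. indicator {t0..t} x *\<^sub>R (f x * g x))
      = (\<lambda>x. indicator {t0..} x * g x * h x + f t * g t * indicator {t} x)"
    using f h0 t by (force simp: indicator_def)
  have J: "integrable lborel (\<lambda>x. f t * g t * indicator {t} x)"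
    by (intro integrable_mult_right) auto
  show "set_integrable lborel {t0..t} (\<lambda>x. f x * g x)"
    unfolding set_integrable_def eq using I(1) J by (rule Bochner_Integration.integrable_add)
  have "(LBINT x:{t0..t}. f x * g x)
    = (\<integral>x. indicator {t0..} x * g x * h x \<partial>lborel) + (\<integral>x. f t * g t * indicator {t} x \<partial>lborel)"
    unfolding set_lebesgue_integral_def eq using I(1) J by (rule Bochner_Integration.integral_add)
  then show "(LBINT x:{t0..t}. f x * g x) = (\<integral>\<omega>. indicator E \<omega> * h (real_of_ereal (T \<omega>)) \<partial>M)"
    unfolding I(2) by simp
qed

section \<open>Decomposition by the boundary that is met first\<close>

lemma differentiable_with_bounded_derivative_continuous_on:
  "differentiable_with_bounded_derivative t0 c \<Longrightarrow> continuous_on {t0..} c"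
  unfolding differentiable_with_bounded_derivative_def
  by (auto simp: continuous_on_eq_continuous_within intro: DERIV_continuous)

text \<open>
  \<open>G\<close> is the identity in the equation for \<open>a\<close> and \<open>v \<mapsto> 1 - v\<close> in the equation for \<open>b\<close>.
\<close>

lemma exit_time_integral:
  fixes X :: "real \<Rightarrow> 'a \<Rightarrow> real" and G :: "real \<Rightarrow> real"
  assumes family: "regular_diffusion_family r1 r2 p Q Y"
    and D: "diffusion_process M t0 X (einterval r1 r2) p x0"
    and a_in: "\<And>t. t0 \<le> t \<Longrightarrow> a t \<in> einterval r1 r2"
    and b_in: "\<And>t. t0 \<le> t \<Longrightarrow> b t \<in> einterval r1 r2"
    and a: "continuous_on {t0..} a" and b: "continuous_on {t0..} b"
    and a_less_b: "\<And>t. t0 \<le> t \<Longrightarrow> a t < b t"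
    and ga: "first_hit_density M t0 (hitting_time t0 X a) (hitting_time t0 X b) ga"
    and gb: "first_hit_density M t0 (hitting_time t0 X b) (hitting_time t0 X a) gb"
    and t: "t0 < t"
    and G[measurable]: "G \<in> borel_measurable borel"
    and G_bound: "\<And>v. 0 \<le> v \<Longrightarrow> v \<le> 1 \<Longrightarrow> \<bar>G v\<bar> \<le> 1"
  defines "S \<equiv> \<lambda>\<omega>. real_of_ereal (min (min (hitting_time t0 X a \<omega>) (hitting_time t0 X b \<omega>)) (ereal t))"
  defines "A \<equiv> {\<omega> \<in> space M. S \<omega> < t}"
  shows "set_integrable lborel {t0..t} (\<lambda>\<tau>. G (cdf (p (t - \<tau>) (a \<tau>)) c) * ga \<tau>)"
    and "set_integrable lborel {t0..t} (\<lambda>\<tau>. G (cdf (p (t - \<tau>) (b \<tau>)) c) * gb \<tau>)"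
    and "(\<integral>\<omega>. indicator A \<omega> * G (cdf (p (t - S \<omega>) (X (S \<omega>) \<omega>)) c) \<partial>M)
      = (LBINT \<tau>:{t0..t}. G (cdf (p (t - \<tau>) (a \<tau>)) c) * ga \<tau>)
        + (LBINT \<tau>:{t0..t}. G (cdf (p (t - \<tau>) (b \<tau>)) c) * gb \<tau>)"
proof -
  note K = family_kernel[OF family]
  interpret prob_space M
    using diffusion_prob_space[OF D K] by simp
  have fin: "finite_measure M" by unfold_locales
  note X = diffusion_continuous[OF D K, simplified]
  have Xm: "X t \<in> borel_measurable M" if "t0 \<le> t" for t
    using diffusion_measurable[OF D K that] by simp
  let ?Ta = "hitting_time t0 X a" and ?Tb = "hitting_time t0 X b"
  have [measurable]: "?Ta \<in> borel_measurable M"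
    using X Xm a by (rule measurable_hitting_time)
  have [measurable]: "?Tb \<in> borel_measurable M"
    using X Xm b by (rule measurable_hitting_time)
  \<comment> \<open>The cutoff at \<open>t\<close> mirrors the event \<open>A\<close>, and it keeps
    the elapsed time \<open>t - \<tau>\<close> positive.\<close>
  define h where "h y \<tau> = (if t0 \<le> \<tau> \<and> \<tau> < t then G (cdf (p (t - \<tau>) (y \<tau>)) c) else 0)" for y \<tau>
  have hm: "h y \<in> borel_measurable borel" and h_bound: "\<bar>h y \<tau>\<bar> \<le> 1"
    if y: "continuous_on {t0..} y" "\<And>\<tau>. t0 \<le> \<tau> \<Longrightarrow> y \<tau> \<in> einterval r1 r2" for y \<tau>
  proof -
    \<comment> \<open>Freezing the boundary before \<open>t0\<close> extends it continuously to the
      whole line with values still in the diffusion interval.\<close>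
    have "continuous_on UNIV (\<lambda>\<tau>. y (max t0 \<tau>))"
      by (rule continuous_on_compose2[OF y(1)]) (auto intro!: continuous_intros)
    then have ym: "(\<lambda>\<tau>. y (max t0 \<tau>)) \<in> borel \<rightarrow>\<^sub>M restrict_space borel (einterval r1 r2)"
      using y(2) by (intro measurable_restrict_space2 borel_measurable_continuous_onI) auto
    have [measurable]: "(\<lambda>\<tau>. if 0 < t - \<tau> then cdf (p (t - \<tau>) (y (max t0 \<tau>))) c else 0)
        \<in> borel_measurable borel"
      by (rule measurable_cdf_compose[OF family ym]) measurable
    have "(\<lambda>\<tau>. if t0 \<le> \<tau> \<and> \<tau> < t
        then G (if 0 < t - \<tau> then cdf (p (t - \<tau>) (y (max t0 \<tau>))) c else 0) else 0)
        \<in> borel_measurable borel"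
      by measurable
    also have "(\<lambda>\<tau>. if t0 \<le> \<tau> \<and> \<tau> < t
        then G (if 0 < t - \<tau> then cdf (p (t - \<tau>) (y (max t0 \<tau>))) c else 0) else 0) = h y"
      by (auto simp: h_def fun_eq_iff max_def)
    finally show "h y \<in> borel_measurable borel" .
    show "\<bar>h y \<tau>\<bar> \<le> 1"
      using y(2) by (auto simp: h_def intro!: G_bound cdf_bounds[OF family])
  qed
  define Ea where "Ea = {\<omega> \<in> space M. ?Ta \<omega> < ?Tb \<omega>}"
  define Eb where "Eb = {\<omega> \<in> space M. ?Tb \<omega> < ?Ta \<omega>}"
  have [measurable]: "Ea \<in> sets M" "Eb \<in> sets M"
    unfolding Ea_def Eb_def by measurable
  note Ia = first_hit_density_set_integral[where h = "h a" and t = t and f = "\<lambda>\<tau>. G (cdf (p (t - \<tau>) (a \<tau>)) c)",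
      OF ga fin _ _ hitting_time_ge hm[OF a a_in] h_bound[OF a a_in], folded Ea_def]
  note Ib = first_hit_density_set_integral[where h = "h b" and t = t and f = "\<lambda>\<tau>. G (cdf (p (t - \<tau>) (b \<tau>)) c)",
      OF gb fin _ _ hitting_time_ge hm[OF b b_in] h_bound[OF b b_in], folded Eb_def]
  show "set_integrable lborel {t0..t} (\<lambda>\<tau>. G (cdf (p (t - \<tau>) (a \<tau>)) c) * ga \<tau>)"
    by (rule Ia(1)) (use t in \<open>auto simp: h_def\<close>)
  show "set_integrable lborel {t0..t} (\<lambda>\<tau>. G (cdf (p (t - \<tau>) (b \<tau>)) c) * gb \<tau>)"
    by (rule Ib(1)) (use t in \<open>auto simp: h_def\<close>)
  \<comment> \<open>If the earlier hitting time is at least \<open>t\<close>, then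
    \<open>S \<omega> = t\<close> and both sides vanish: the left because \<open>\<omega>\<close> is
    outside \<open>A\<close>, the right because \<open>h\<close> is cut off. If it is smaller, it
    equals \<open>S \<omega>\<close>, and the state there is the boundary value.\<close>
  have split: "indicator A \<omega> * G (cdf (p (t - S \<omega>) (X (S \<omega>) \<omega>)) c)
      = indicator Ea \<omega> * h a (real_of_ereal (?Ta \<omega>)) + indicator Eb \<omega> * h b (real_of_ereal (?Tb \<omega>))"
    if \<omega>: "\<omega> \<in> space M" for \<omega>
  proof -
    note Ca = hitting_time_cases[where X = X and \<omega> = \<omega>, OF X[OF \<omega>] a] and Cb = hitting_time_cases[where X = X and \<omega> = \<omega>, OF X[OF \<omega>] b]
    consider (a_first) s where "?Ta \<omega> = ereal s" "t0 \<le> s" "X s \<omega> = a s" "?Ta \<omega> < ?Tb \<omega>"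
      | (b_first) s where "?Tb \<omega> = ereal s" "t0 \<le> s" "X s \<omega> = b s" "?Tb \<omega> < ?Ta \<omega>"
      | (neither) "?Ta \<omega> = \<infinity>" "?Tb \<omega> = \<infinity>"
    proof (cases "?Ta \<omega>" "?Tb \<omega>" rule: linorder_cases)
      case less
      show thesis by (rule Ca) (use less a_first in auto)
    next
      case greater
      show thesis by (rule Cb) (use greater b_first in auto)
    next
      \<comment> \<open>A common finite hitting time \<open>s\<close> would give
        \<open>a s = b s\<close>; hence a tie is possible only at infinity.\<close>
      case equal
      show thesis
      proof (rule Ca)
        fix s assume s: "?Ta \<omega> = ereal s" "t0 \<le> s" "X s \<omega> = a s"
        then have "X s \<omega> = b s"
          using equal by (intro hitting_time_attained[where X = X and \<omega> = \<omega>, OF X[OF \<omega>] b]) auto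
        then show thesis using s a_less_b[OF s(2)] by auto
      qed (use equal neither in auto)
    qed
    then show ?thesis
    proof cases
      case a_first
      then have "S \<omega> = min s t"
        by (auto simp: S_def min_def)
      then show ?thesis
        using a_first \<omega> by (auto simp: A_def Ea_def Eb_def h_def indicator_def min_def)
    next
      case b_first
      then have "S \<omega> = min s t"
        by (auto simp: S_def min_def)
      then show ?thesis
        using b_first \<omega> by (auto simp: A_def Ea_def Eb_def h_def indicator_def min_def)
    next
      \<comment> \<open>The strict inequalities exclude both \<open>Ea\<close> and
        \<open>Eb\<close>, so the value of \<open>real_of_ereal\<close> at infinity does not matter;
        moreover \<open>S \<omega> = t\<close>.\<close>
      case neither
      then show ?thesis by (auto simp: A_def Ea_def Eb_def S_def)
    qed
  qed
  have int_a: "integrable M (\<lambda>\<omega>. indicator Ea \<omega> * h a (real_of_ereal (?Ta \<omega>)))"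
    using hm[OF a a_in] h_bound[OF a a_in]
    by (intro integrable_const_bound[where B = 1]) (auto intro!: AE_I2 simp: indicator_def)
  have int_b: "integrable M (\<lambda>\<omega>. indicator Eb \<omega> * h b (real_of_ereal (?Tb \<omega>)))"
    using hm[OF b b_in] h_bound[OF b b_in]
    by (intro integrable_const_bound[where B = 1]) (auto intro!: AE_I2 simp: indicator_def)
  have "(\<integral>\<omega>. indicator A \<omega> * G (cdf (p (t - S \<omega>) (X (S \<omega>) \<omega>)) c) \<partial>M)
    = (\<integral>\<omega>. indicator Ea \<omega> * h a (real_of_ereal (?Ta \<omega>))
      + indicator Eb \<omega> * h b (real_of_ereal (?Tb \<omega>)) \<partial>M)"
    by (intro Bochner_Integration.integral_cong refl split)
  also have "\<dots> = (\<integral>\<omega>. indicator Ea \<omega> * h a (real_of_ereal (?Ta \<omega>)) \<partial>M)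
      + (\<integral>\<omega>. indicator Eb \<omega> * h b (real_of_ereal (?Tb \<omega>)) \<partial>M)"
    by (rule Bochner_Integration.integral_add[OF int_a int_b])
  also have "(\<integral>\<omega>. indicator Ea \<omega> * h a (real_of_ereal (?Ta \<omega>)) \<partial>M)
      = (LBINT \<tau>:{t0..t}. G (cdf (p (t - \<tau>) (a \<tau>)) c) * ga \<tau>)"
    by (rule Ia(2)[symmetric]) (use t in \<open>auto simp: h_def\<close>)
  also have "(\<integral>\<omega>. indicator Eb \<omega> * h b (real_of_ereal (?Tb \<omega>)) \<partial>M)
      = (LBINT \<tau>:{t0..t}. G (cdf (p (t - \<tau>) (b \<tau>)) c) * gb \<tau>)"
    by (rule Ib(2)[symmetric]) (use t in \<open>auto simp: h_def\<close>)
  finally show "(\<integral>\<omega>. indicator A \<omega> * G (cdf (p (t - S \<omega>) (X (S \<omega>) \<omega>)) c) \<partial>M)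
      = (LBINT \<tau>:{t0..t}. G (cdf (p (t - \<tau>) (a \<tau>)) c) * ga \<tau>)
        + (LBINT \<tau>:{t0..t}. G (cdf (p (t - \<tau>) (b \<tau>)) c) * gb \<tau>)" .
qed

section \<open>The two Volterra equations\<close>

theorem theorem3p1:
  fixes M :: "'a measure" and X :: "real \<Rightarrow> 'a \<Rightarrow> real"
    and Q :: "real \<Rightarrow> 'b measure" and Y :: "real \<Rightarrow> 'b \<Rightarrow> real"
    and p :: "real \<Rightarrow> real \<Rightarrow> real measure"
    and r1 r2 :: ereal and t0 x0 :: real
    and a b ga gb :: "real \<Rightarrow> real"
  assumes family: "regular_diffusion_family r1 r2 p Q Y"
    and diffusion: "diffusion_process M t0 X (einterval r1 r2) p x0"
    and a_in: "\<And>t. t0 \<le> t \<Longrightarrow> a t \<in> einterval r1 r2"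
    and b_in: "\<And>t. t0 \<le> t \<Longrightarrow> b t \<in> einterval r1 r2"
    and a_deriv: "differentiable_with_bounded_derivative t0 a"
    and b_deriv: "differentiable_with_bounded_derivative t0 b"
    and start: "a t0 < x0" "x0 < b t0"
    and a_less_b: "\<And>t. t0 < t \<Longrightarrow> a t < b t"
    and ga: "first_hit_density M t0 (hitting_time t0 X a) (hitting_time t0 X b) ga"
    and gb: "first_hit_density M t0 (hitting_time t0 X b) (hitting_time t0 X a) gb"
  shows "\<forall>t>t0.
    set_integrable lborel {t0..t} (\<lambda>\<tau>. (1 - transition_cdf p t (b t) (a \<tau>) \<tau>) * ga \<tau>) \<and>
    set_integrable lborel {t0..t} (\<lambda>\<tau>. (1 - transition_cdf p t (b t) (b \<tau>) \<tau>) * gb \<tau>) \<and>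
    set_integrable lborel {t0..t} (\<lambda>\<tau>. transition_cdf p t (a t) (a \<tau>) \<tau> * ga \<tau>) \<and>
    set_integrable lborel {t0..t} (\<lambda>\<tau>. transition_cdf p t (a t) (b \<tau>) \<tau> * gb \<tau>) \<and>
    1 - transition_cdf p t (b t) x0 t0 =
      (LBINT \<tau>:{t0..t}. (1 - transition_cdf p t (b t) (a \<tau>) \<tau>) * ga \<tau>) +
      (LBINT \<tau>:{t0..t}. (1 - transition_cdf p t (b t) (b \<tau>) \<tau>) * gb \<tau>) \<and>
    transition_cdf p t (a t) x0 t0 =
      (LBINT \<tau>:{t0..t}. transition_cdf p t (a t) (a \<tau>) \<tau> * ga \<tau>) +
      (LBINT \<tau>:{t0..t}. transition_cdf p t (a t) (b \<tau>) \<tau> * gb \<tau>)"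
proof (intro allI impI)
  fix t assume t: "t0 < t"
  note K = family_kernel[OF family]
  interpret prob_space M
    using diffusion_prob_space[OF diffusion K] by simp
  note X = diffusion_continuous[OF diffusion K, simplified]
  have [measurable]: "X t \<in> borel_measurable M"
    using diffusion_measurable[OF diffusion K, of t] t by simp
  have a: "continuous_on {t0..} a" and b: "continuous_on {t0..} b"
    using a_deriv b_deriv by (auto intro: differentiable_with_bounded_derivative_continuous_on)
  \<comment> \<open>The ordering after \<open>t0\<close> is assumed directly; at \<open>t0\<close>
    it comes from the position of \<open>x0\<close> between the boundaries.\<close>
  have less: "a s < b s" if "t0 \<le> s" for s
    using that a_less_b[of s] start by (cases "s = t0") auto
  let ?Ta = "hitting_time t0 X a" and ?Tb = "hitting_time t0 X b"
  define S where "S \<omega> = real_of_ereal (min (min (?Ta \<omega>) (?Tb \<omega>)) (ereal t))" for \<omega>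
  define A where "A = {\<omega> \<in> space M. S \<omega> < t}"
  \<comment> \<open>On \<open>A\<close>, the probability of being at most \<open>c\<close> at time
    \<open>t\<close> after restarting from the state at time \<open>S \<omega>\<close>.\<close>
  define \<phi> where "\<phi> c \<omega> = cdf (p (t - S \<omega>) (X (S \<omega>) \<omega>)) c" for c \<omega>
  have S: "stopping_time (natural_filtration M t0 X) S"
    unfolding S_def by (rule stopping_time_truncated_hitting_times[OF X a b])
  have S_ge: "t0 \<le> S \<omega>" for \<omega>
    using hitting_time_ge[of t0 X a \<omega>] hitting_time_ge[of t0 X b \<omega>] t
    by (cases "?Ta \<omega>"; cases "?Tb \<omega>") (auto simp: S_def min_def)
  have [measurable]: "S \<in> borel_measurable M"
    using diffusion_stopping_time_measurable[OF diffusion K S] by simp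
  have [measurable]: "A \<in> sets M" unfolding A_def by measurable
  have A_iff: "\<omega> \<in> A \<longleftrightarrow> ?Ta \<omega> < ereal t \<or> ?Tb \<omega> < ereal t" if "\<omega> \<in> space M" for \<omega>
    using that hitting_time_ge[of t0 X a \<omega>] hitting_time_ge[of t0 X b \<omega>]
    by (cases "?Ta \<omega>"; cases "?Tb \<omega>") (auto simp: A_def S_def min_def)
  \<comment> \<open>The path starts above \<open>a\<close> and ends below it, so it meets
    \<open>a\<close>. As \<open>X t \<omega>\<close> differs from \<open>a t\<close>, this happens
    strictly before \<open>t\<close>, as membership in \<open>A\<close> demands.
    \<open>A_high\<close> is the mirror image.\<close>
  have A_low: "\<omega> \<in> A" if \<omega>: "\<omega> \<in> space M" "X t0 \<omega> = x0" "X t \<omega> < a t" for \<omega>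
  proof -
    have "continuous_on {t0..t} (\<lambda>s. X s \<omega> - a s)"
      by (intro continuous_intros continuous_on_subset[OF X[OF \<omega>(1)]] continuous_on_subset[OF a]) auto
    then obtain s where s: "t0 \<le> s" "s \<le> t" "X s \<omega> - a s = 0"
      using IVT2'[of "\<lambda>s. X s \<omega> - a s" t 0 t0] \<omega> start t by auto
    then have "s < t" using \<omega>(3) by (cases "s = t") auto
    moreover have "?Ta \<omega> \<le> ereal s"
      using s by (subst hitting_time_le_iff[where X = X and \<omega> = \<omega>, OF X[OF \<omega>(1)] a]) auto
    ultimately show ?thesis
      using A_iff[OF \<omega>(1)] by (meson ereal_less(2) less_ereal.simps(1) order_le_less_trans)
  qed
  have A_high: "\<omega> \<in> A" if \<omega>: "\<omega> \<in> space M" "X t0 \<omega> = x0" "b t < X t \<omega>" for \<omega>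
  proof -
    have "continuous_on {t0..t} (\<lambda>s. X s \<omega> - b s)"
      by (intro continuous_intros continuous_on_subset[OF X[OF \<omega>(1)]] continuous_on_subset[OF b]) auto
    then obtain s where s: "t0 \<le> s" "s \<le> t" "X s \<omega> - b s = 0"
      using IVT'[of "\<lambda>s. X s \<omega> - b s" t0 0 t] \<omega> start t by auto
    then have "s < t" using \<omega>(3) by (cases "s = t") auto
    moreover have "?Tb \<omega> \<le> ereal s"
      using s by (subst hitting_time_le_iff[where X = X and \<omega> = \<omega>, OF X[OF \<omega>(1)] b]) auto
    ultimately show ?thesis
      using A_iff[OF \<omega>(1)] by (meson ereal_less(2) less_ereal.simps(1) order_le_less_trans)
  qed
  have markov: "(\<integral>\<omega>. indicator A \<omega> * indicator {..c} (X t \<omega>) \<partial>M) = (\<integral>\<omega>. indicator A \<omega> * \<phi> c \<omega> \<partial>M)" for c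
    unfolding A_def \<phi>_def by (rule markov_remaining_time[OF family diffusion S S_ge t])
  have cdf_eq: "transition_cdf p t c x0 t0
      = (\<integral>\<omega>. indicator (space M) \<omega> * indicator {..c} (X t \<omega>) \<partial>M)" for c
    using diffusion_cdf[OF diffusion K, of t c] t by (simp add: transition_cdf_def)
  have no_atom: "AE \<omega> in M. X t \<omega> \<noteq> c" for c
    using t diffusion_start_mem[OF diffusion K]
    by (intro diffusion_no_atom[OF diffusion K]) (auto intro!: family_no_atom[OF family])
  have start_AE: "AE \<omega> in M. X t0 \<omega> = x0"
    using diffusion_start[OF diffusion K] by simp
  \<comment> \<open>The event \<open>X t \<omega> = a t\<close> has to be discarded as null: the
    first contact could then occur exactly at \<open>t\<close>, outside \<open>A\<close>. The
    remaining event \<open>X t \<omega> < a t\<close> is covered by \<open>A_low\<close>.\<close>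
  have low: "transition_cdf p t (a t) x0 t0 = (\<integral>\<omega>. indicator A \<omega> * \<phi> (a t) \<omega> \<partial>M)"
    unfolding cdf_eq markov[symmetric]
  proof (rule integral_cong_AE)
    show "AE \<omega> in M. indicator (space M) \<omega> * indicator {..a t} (X t \<omega>)
        = (indicator A \<omega> * indicator {..a t} (X t \<omega>) :: real)"
      using no_atom[of "a t"] start_AE AE_space
    proof eventually_elim
      case (elim \<omega>)
      then show ?case using A_low[of \<omega>] by (cases "\<omega> \<in> A") (auto simp: indicator_def)
    qed
  qed measurable
  have \<phi>m: "(\<lambda>\<omega>. indicator A \<omega> * \<phi> c \<omega>) \<in> borel_measurable M" for c
  proof -
    have "(\<lambda>\<omega>. X (S \<omega>) \<omega>) \<in> M \<rightarrow>\<^sub>M restrict_space borel (einterval r1 r2)"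
      using diffusion_measurable_random_time[OF diffusion K, of S] S_ge diffusion_mem[OF diffusion K]
      by (intro measurable_restrict_space2) auto
    then have "(\<lambda>\<omega>. if 0 < t - S \<omega> then cdf (p (t - S \<omega>) (X (S \<omega>) \<omega>)) c else 0) \<in> borel_measurable M"
      by (rule measurable_cdf_compose[OF family]) measurable
    then show ?thesis
      by (rule measurable_cong[THEN iffD1, rotated]) (auto simp: A_def \<phi>_def)
  qed
  have \<phi>_bounds: "\<bar>indicator A \<omega> * \<phi> c \<omega>\<bar> \<le> 1" if "\<omega> \<in> space M" for c \<omega>
  proof (cases "\<omega> \<in> A")
    case True
    then have "0 \<le> t - S \<omega>" by (simp add: A_def)
    from cdf_bounds[OF family this diffusion_mem[OF diffusion K that S_ge]]
    show ?thesis by (auto simp: \<phi>_def indicator_def)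
  qed simp
  have \<phi>_int: "integrable M (\<lambda>\<omega>. indicator A \<omega> * \<phi> c \<omega>)" for c
    using \<phi>m \<phi>_bounds by (intro integrable_const_bound[where B = 1]) (auto intro!: AE_I2)
  have A_int: "integrable M (indicator A :: 'a \<Rightarrow> real)"
    by (simp add: emeasure_eq_measure)
  have ind_int: "integrable M (\<lambda>\<omega>. indicator B \<omega> * indicator {..c} (X t \<omega>) :: real)"
    if [measurable]: "B \<in> sets M" for B c
    by (rule integrable_const_bound[where B = 1]) (auto intro!: AE_I2 simp: indicator_def)
  \<comment> \<open>The complement of \<open>{..b t}\<close> is the strict event
    \<open>b t < X t \<omega>\<close>, which lies in \<open>A\<close> almost surely by
    \<open>A_high\<close>; so its indicator may be multiplied by that of \<open>A\<close>.\<close>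
  have high: "1 - transition_cdf p t (b t) x0 t0 = (\<integral>\<omega>. indicator A \<omega> * (1 - \<phi> (b t) \<omega>) \<partial>M)"
  proof -
    have "1 - transition_cdf p t (b t) x0 t0
        = (\<integral>\<omega>. 1 - indicator (space M) \<omega> * indicator {..b t} (X t \<omega>) \<partial>M)"
      unfolding cdf_eq using ind_int[OF sets.top, of "b t"]
      by (subst Bochner_Integration.integral_diff) (auto simp: prob_space)
    also have "\<dots> = (\<integral>\<omega>. indicator A \<omega> - indicator A \<omega> * indicator {..b t} (X t \<omega>) \<partial>M)"
    proof (rule integral_cong_AE)
      show "AE \<omega> in M. 1 - indicator (space M) \<omega> * indicator {..b t} (X t \<omega>)
          = (indicator A \<omega> - indicator A \<omega> * indicator {..b t} (X t \<omega>) :: real)"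
        using start_AE AE_space
      proof eventually_elim
        case (elim \<omega>)
        then show ?case using A_high[of \<omega>] by (cases "\<omega> \<in> A") (auto simp: indicator_def intro: leI)
      qed
    qed measurable
    \<comment> \<open>\<open>markov\<close> equates integrals, not integrands, so the replacement
      goes through linearity, with every term integrable.\<close>
    also have "\<dots> = (\<integral>\<omega>. indicator A \<omega> - indicator A \<omega> * \<phi> (b t) \<omega> \<partial>M)"
      using A_int ind_int[of A "b t"] \<phi>_int[of "b t"] by (simp add: markov)
    finally show ?thesis by (simp add: right_diff_distrib)
  qed
  note E = exit_time_integral[OF family diffusion a_in b_in a b less ga gb t, folded S_def[abs_def]]
  note U = E[where G = "\<lambda>v. 1 - v" and c = "b t", folded S_def A_def \<phi>_def]
  note L = E[where G = "\<lambda>v. v" and c = "a t", folded S_def A_def \<phi>_def]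
  show "set_integrable lborel {t0..t} (\<lambda>\<tau>. (1 - transition_cdf p t (b t) (a \<tau>) \<tau>) * ga \<tau>) \<and>
    set_integrable lborel {t0..t} (\<lambda>\<tau>. (1 - transition_cdf p t (b t) (b \<tau>) \<tau>) * gb \<tau>) \<and>
    set_integrable lborel {t0..t} (\<lambda>\<tau>. transition_cdf p t (a t) (a \<tau>) \<tau> * ga \<tau>) \<and>
    set_integrable lborel {t0..t} (\<lambda>\<tau>. transition_cdf p t (a t) (b \<tau>) \<tau> * gb \<tau>) \<and>
    1 - transition_cdf p t (b t) x0 t0 =
      (LBINT \<tau>:{t0..t}. (1 - transition_cdf p t (b t) (a \<tau>) \<tau>) * ga \<tau>) +
      (LBINT \<tau>:{t0..t}. (1 - transition_cdf p t (b t) (b \<tau>) \<tau>) * gb \<tau>) \<and>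
    transition_cdf p t (a t) x0 t0 =
      (LBINT \<tau>:{t0..t}. transition_cdf p t (a t) (a \<tau>) \<tau> * ga \<tau>) +
      (LBINT \<tau>:{t0..t}. transition_cdf p t (a t) (b \<tau>) \<tau> * gb \<tau>)"
    unfolding high low unfolding transition_cdf_def
    by (intro conjI U L) auto
qed

end
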